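(* For any $\kappa>0$ (sphere $\mathbb S_\kappa^2$) and masses $m_1=:M>0$, $m_2=m_3=:m>0$, with $M<2m$, there exist two non-geodesic circles of $\mathbb S_\kappa^2$ parallel with the plane of the equator, symmetrically placed at distance $r\kappa^{-1/2}$ from it, such that the three bodies can form isosceles, non-equilateral, relative equilibria that rotate on any of those parallel circles. Moreover, (i) the shape of the triangle is unique if $r\in(0,\sqrt3/3]\cup\{3/5\}$; (ii) there are two possible shapes of the triangle if $r\in(\sqrt3/3,3/5)$. In each case the rotation takes place with constant nonzero angular velocity, whose value depends on $\kappa$, $m$, and $M$.
   Context: For $\kappa>0$ let $\mathbb S_\kappa^2=\{(x,y,z)\in\mathbb R^3 : \kappa(x^2+y^2+z^2)+2\kappa^{1/2}z=0\}$, the sphere of radius $\kappa^{-1/2}$ centred at $(0,0,-\kappa^{-1/2})$. Its equator is the circle in the plane $z=-\kappa^{-1/2}$. Bodies of masses $m_1,m_2,m_3$ have positions ${\bf r}_i=(x_i,y_i,z_i)\in\mathbb S_\kappa^2$. With $r_{ij}=[(x_i-x_j)^2+(y_i-y_j)^2+(z_i-z_j)^2]^{1/2}$ and $\dot{\bf r}_i\cdot\dot{\bf r}_i=\dot x_i^2+\dot y_i^2+\dot z_i^2$, the equations of motion of the curved 3-body problem are, for $i=1,2,3$, $$\ddot x_i=\sum_{j\ne i}\frac{m_j\big[x_j-\big(1-\frac{\kappa r_{ij}^2}{2}\big)x_i\big]}{r_{ij}^3\big(1-\frac{\kappa r_{ij}^2}{4}\big)^{3/2}}-\kappa(\dot{\bf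 r}_i\cdot\dot{\bf r}_i)x_i,$$ the same equation with $y$ in place of $x$, and $$\ddot z_i=\sum_{j\ne i}\frac{m_j\big[z_j-\big(1-\frac{\kappa r_{ij}^2}{2}\big)z_i+\frac{\kappa^{1/2}r_{ij}^2}{2}\big]}{r_{ij}^3\big(1-\frac{\kappa r_{ij}^2}{4}\big)^{3/2}}-(\dot{\bf r}_i\cdot\dot{\bf r}_i)(\kappa z_i+\kappa^{1/2}).$$ Collisions and antipodal configurations are excluded (the equations are undefined there). A relative equilibrium is a solution in which all bodies rotate about the $z$-axis with the same constant angular velocity $\alpha\neq0$, with each $z_i$ constant. A relative equilibrium rotating on a circle parallel with the plane of the equator is one with $z_1=z_2=z_3$ (the circle is non-geodesic when this common value differs from $-\kappa^{-1/2}$); it has the form $x_i=\varrho\cos(\alpha t+a_i)$, $y_i=\varrho\sin(\alpha t+a_i)$, $\varrho>0$. It is isosceles (equilateral) if the triangle with vertices ${\bf r}_1,{\bf r}_2,{\bf r}_3$ is isosceles (equilateral); the shape of the triangle is its class up to congruence/similarity.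
   Formalization: Existence is stated for M ≠ m only, since for M = m such a relative equilibrium on a non-geodesic circle is equilateral; at r = √3/3 only "at most one shape" is claimed, since there the only candidates are the equilateral triangle and M = 0. *)

theory Defs
  imports "HOL-Analysis.Analysis"
begin

definition curved_sphere :: "real \<Rightarrow> (real^3) set" where
  "curved_sphere \<kappa> =
     {p. \<kappa> * ((p$1)\<^sup>2 + (p$2)\<^sup>2 + (p$3)\<^sup>2) + 2 * sqrt \<kappa> * p$3 = 0}"

text \<open>The right-hand side of the equations of motion for body \<open>i\<close>, at positions \<open>p\<close> and
  velocities \<open>v\<close>. Written as a vector: the extra terms of the \<open>z\<close>-equation are carried by the
  multiples of \<open>axis 3 1\<close>, the third unit vector.\<close>

definition curved_acceleration ::
    "real \<Rightarrow> (3 \<Rightarrow> real) \<Rightarrow> (3 \<Rightarrow> real^3) \<Rightarrow> (3 \<Rightarrow> real^3) \<Rightarrow> 3 \<Rightarrow> real^3" where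
  "curved_acceleration \<kappa> mass p v i =
     (\<Sum>j\<in>UNIV - {i}.
        (mass j / ((dist (p i) (p j)) ^ 3 *
                   (1 - \<kappa> * (dist (p i) (p j))\<^sup>2 / 4) powr (3/2))) *\<^sub>R
        (p j - (1 - \<kappa> * (dist (p i) (p j))\<^sup>2 / 2) *\<^sub>R p i
             + (sqrt \<kappa> * (dist (p i) (p j))\<^sup>2 / 2) *\<^sub>R axis 3 1))
     - (v i \<bullet> v i) *\<^sub>R (\<kappa> *\<^sub>R p i + sqrt \<kappa> *\<^sub>R axis 3 1)"

text \<open>On the sphere of radius \<open>1 / sqrt \<kappa>\<close>, two points \<open>p\<close>, \<open>q\<close> are antipodal iff
  \<open>\<kappa> * (dist p q)\<^sup>2 = 4\<close>.\<close>

definition curved_solution ::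
    "real \<Rightarrow> (3 \<Rightarrow> real) \<Rightarrow> (3 \<Rightarrow> real \<Rightarrow> real^3) \<Rightarrow> bool" where
  "curved_solution \<kappa> mass q \<longleftrightarrow>
     (\<forall>i t. q i t \<in> curved_sphere \<kappa>) \<and>
     (\<forall>i j t. i \<noteq> j \<longrightarrow> q i t \<noteq> q j t \<and> \<kappa> * (dist (q i t) (q j t))\<^sup>2 \<noteq> 4) \<and>
     (\<exists>v. \<forall>i t.
        (q i has_vector_derivative v i t) (at t) \<and>
        (v i has_vector_derivative
           curved_acceleration \<kappa> mass (\<lambda>j. q j t) (\<lambda>j. v j t) i) (at t))"

definition relative_equilibrium ::
    "real \<Rightarrow> (3 \<Rightarrow> real) \<Rightarrow> real \<Rightarrow> (3 \<Rightarrow> real \<Rightarrow> real^3) \<Rightarrow> bool" where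
  "relative_equilibrium \<kappa> mass \<alpha> q \<longleftrightarrow>
     \<alpha> \<noteq> 0 \<and> curved_solution \<kappa> mass q \<and>
     (\<forall>i. \<exists>\<rho> a z. \<rho> \<ge> 0 \<and>
        (\<forall>t. q i t = vector [\<rho> * cos (\<alpha> * t + a), \<rho> * sin (\<alpha> * t + a), z]))"

text \<open>All bodies stay in the plane at height \<open>h\<close>. They then share one circle of positive radius:
  the radius is determined by \<open>h\<close>, and radius zero is excluded by the absence of collisions.
  The equator is at height \<open>h = - 1 / sqrt \<kappa>\<close>.\<close>

definition relative_equilibrium_at_height ::
    "real \<Rightarrow> (3 \<Rightarrow> real) \<Rightarrow> real \<Rightarrow> real \<Rightarrow> (3 \<Rightarrow> real \<Rightarrow> real^3) \<Rightarrow> bool" where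
  "relative_equilibrium_at_height \<kappa> mass \<alpha> h q \<longleftrightarrow>
     relative_equilibrium \<kappa> mass \<alpha> q \<and> (\<forall>i t. q i t $ 3 = h)"

text \<open>Any vertex may be the apex. Degenerate triples need no separate exclusion below:
  three distinct points of a circle are not collinear.\<close>

definition isosceles :: "(3 \<Rightarrow> real^3) \<Rightarrow> bool" where
  "isosceles p \<longleftrightarrow>
     (\<exists>i j k. i \<noteq> j \<and> j \<noteq> k \<and> i \<noteq> k \<and> dist (p i) (p j) = dist (p i) (p k))"

definition equilateral :: "(3 \<Rightarrow> real^3) \<Rightarrow> bool" where
  "equilateral p \<longleftrightarrow> (\<exists>s. \<forall>i j. i \<noteq> j \<longrightarrow> dist (p i) (p j) = s)"

definition isosceles_RE ::
    "real \<Rightarrow> real \<Rightarrow> real \<Rightarrow> real \<Rightarrow> real \<Rightarrow> (3 \<Rightarrow> real \<Rightarrow> real^3) \<Rightarrow> bool" where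
  "isosceles_RE \<kappa> M m \<alpha> h q \<longleftrightarrow>
     relative_equilibrium_at_height \<kappa> (\<lambda>i. if i = 1 then M else m) \<alpha> h q \<and>
     (\<forall>t. isosceles (\<lambda>i. q i t) \<and> \<not> equilateral (\<lambda>i. q i t))"

definition similarity :: "((real^3) set \<times> (real^3) set) set" where
  "similarity = {(S, T). \<exists>c>0. \<exists>f. (\<forall>x y. dist (f x) (f y) = c * dist x y) \<and> f ` S = T}"

text \<open>The triangles, as vertex sets, formed on the two circles at distance \<open>r / sqrt \<kappa>\<close> from the
  plane of the equator; the masses are not fixed. Since the vertices lie on circles
  of one radius, similar triangles of this set are congruent.\<close>

definition RE_triangles :: "real \<Rightarrow> real \<Rightarrow> (real^3) set set" where
  "RE_triangles \<kappa> r =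
     {range (\<lambda>i. q i t) | q t. \<exists>M m \<alpha> h. 0 < M \<and> 0 < m \<and> M < 2 * m \<and>
        \<bar>h - (- 1 / sqrt \<kappa>)\<bar> = r / sqrt \<kappa> \<and> isosceles_RE \<kappa> M m \<alpha> h q}"

definition RE_shapes :: "real \<Rightarrow> real \<Rightarrow> (real^3) set set set" where
  "RE_shapes \<kappa> r = RE_triangles \<kappa> r // similarity"

text \<open>A function \<open>\<omega>\<close> of \<open>\<kappa>\<close>, \<open>m\<close>, \<open>M\<close> that is not independent of any of its arguments on the
  parameter domain \<open>D\<close>.\<close>

definition depends_on_each :: "(real \<Rightarrow> real \<Rightarrow> real \<Rightarrow> bool) \<Rightarrow> (real \<Rightarrow> real \<Rightarrow> real \<Rightarrow> real) \<Rightarrow> bool" where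
  "depends_on_each D \<omega> \<longleftrightarrow>
     (\<exists>\<kappa> \<kappa>' m M. D \<kappa> m M \<and> D \<kappa>' m M \<and> \<omega> \<kappa> m M \<noteq> \<omega> \<kappa>' m M) \<and>
     (\<exists>\<kappa> m m' M. D \<kappa> m M \<and> D \<kappa> m' M \<and> \<omega> \<kappa> m M \<noteq> \<omega> \<kappa> m' M) \<and>
     (\<exists>\<kappa> m M M'. D \<kappa> m M \<and> D \<kappa> m M' \<and> \<omega> \<kappa> m M \<noteq> \<omega> \<kappa> m M')"

end

theory Submission
  imports Defs
begin

text \<open>
  Put three bodies at phases \<open>b\<^sub>1, b\<^sub>2, b\<^sub>3\<close> on a non-geodesic circle of Euclidean radius \<open>P\<close>. For a rigid
  rotation the equations of motion split into a tangential balance \<open>\<Sum> m\<^sub>j g\<^sub>i\<^sub>j sin (b\<^sub>j - b\<^sub>i) = 0\<close> and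
  a radial one \<open>\<Sum> m\<^sub>j g\<^sub>i\<^sub>j (1 - cos (b\<^sub>j - b\<^sub>i)) = \<alpha>\<^sup>2\<close>. For masses \<open>M, m, m\<close> these force the body of mass
  \<open>M\<close> to be the apex of an isosceles triangle and all weights \<open>g\<^sub>i\<^sub>j\<close> to agree; with \<open>x\<close> the cosine of the
  angle between the apex and a base vertex, this gives \<open>M = - 2 m x\<close>. The weight takes equal values at
  geodesic distances \<open>d\<close> and \<open>\<pi> - d\<close> (in units of the radius of the sphere), so a non-equilateral
  solution has base and leg adding up to half a great circle, that is
  \<open>(1 - r\<^sup>2) (1 - x) (3 + 2 x) = 2\<close>. Counting the roots \<open>x \<in> (-1, 0) - {-1/2}\<close> of this
  quadratic gives the number of shapes.
\<close>

subsection \<open>Rigid rotation on a circle parallel with the equator\<close>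

definition circle_point :: "real \<Rightarrow> real \<Rightarrow> real \<Rightarrow> real^3" where
  "circle_point P h \<theta> = vector [P * cos \<theta>, P * sin \<theta>, h]"

text \<open>The weight \<open>1 / (d ^ 3 * (1 - \<kappa> * d\<^sup>2 / 4) powr (3/2))\<close> of the attraction, as a function of the
  cosine \<open>c\<close> of the phase difference: there \<open>d\<^sup>2 = 2 * P\<^sup>2 * (1 - c)\<close>.\<close>

definition pair_weight :: "real \<Rightarrow> real \<Rightarrow> real \<Rightarrow> real" where
  "pair_weight \<kappa> P c = 1 / (P\<^sup>2 * (1 - c) * (2 - \<kappa> * P\<^sup>2 * (1 - c))) powr (3/2)"

definition tangential_pull ::
    "real \<Rightarrow> (3 \<Rightarrow> real) \<Rightarrow> real \<Rightarrow> (3 \<Rightarrow> real) \<Rightarrow> 3 \<Rightarrow> real" where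
  "tangential_pull \<kappa> mass P b i =
     (\<Sum>j\<in>UNIV - {i}. mass j * pair_weight \<kappa> P (cos (b j - b i)) * sin (b j - b i))"

definition radial_pull ::
    "real \<Rightarrow> (3 \<Rightarrow> real) \<Rightarrow> real \<Rightarrow> (3 \<Rightarrow> real) \<Rightarrow> 3 \<Rightarrow> real" where
  "radial_pull \<kappa> mass P b i =
     (\<Sum>j\<in>UNIV - {i}. mass j * pair_weight \<kappa> P (cos (b j - b i)) * (1 - cos (b j - b i)))"

text \<open>No two bodies collide or are antipodal.\<close>

definition separated :: "real \<Rightarrow> real \<Rightarrow> (3 \<Rightarrow> real) \<Rightarrow> bool" where
  "separated \<kappa> P b \<longleftrightarrow>
     (\<forall>i j. i \<noteq> j \<longrightarrow> cos (b j - b i) < 1 \<and> \<kappa> * P\<^sup>2 * (1 - cos (b j - b i)) < 2)"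

lemma circle_point_nth [simp]:
  "circle_point P h \<theta> $ 1 = P * cos \<theta>"
  "circle_point P h \<theta> $ 2 = P * sin \<theta>"
  "circle_point P h \<theta> $ 3 = h"
  by (simp_all add: circle_point_def)

lemma dist_circle_point:
  "(dist (circle_point P h a) (circle_point P h b))\<^sup>2 = 2 * P\<^sup>2 * (1 - cos (b - a))"
proof -
  have "(dist (circle_point P h a) (circle_point P h b))\<^sup>2
      = (P * cos a - P * cos b)\<^sup>2 + (P * sin a - P * sin b)\<^sup>2"
    unfolding dist_norm power2_norm_eq_inner
    by (simp add: inner_vec_def sum_3 power2_eq_square)
  also have "\<dots> = P\<^sup>2 * (((sin a)\<^sup>2 + (cos a)\<^sup>2) + ((sin b)\<^sup>2 + (cos b)\<^sup>2)
      - 2 * (cos b * cos a + sin b * sin a))"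
    by algebra
  finally show ?thesis
    by (simp add: cos_diff algebra_simps)
qed

text \<open>Completing the square in the third coordinate turns the equation of the sphere into
  Pythagoras for the radius of the circle and its height over the equatorial plane, in units of the
  radius of the sphere.\<close>

lemma circle_point_in_curved_sphere:
  assumes "\<kappa> > 0"
  shows "circle_point P h \<theta> \<in> curved_sphere \<kappa> \<longleftrightarrow> \<kappa> * P\<^sup>2 + (sqrt \<kappa> * h + 1)\<^sup>2 = 1"
proof -
  have "(P * cos \<theta>)\<^sup>2 + (P * sin \<theta>)\<^sup>2 = P\<^sup>2 * ((sin \<theta>)\<^sup>2 + (cos \<theta>)\<^sup>2)"
    by algebra
  then have "(P * cos \<theta>)\<^sup>2 + (P * sin \<theta>)\<^sup>2 = P\<^sup>2"
    by simp
  moreover have "(sqrt \<kappa> * h + 1)\<^sup>2 = \<kappa> * h\<^sup>2 + 2 * sqrt \<kappa> * h + 1"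
    using assms by (simp add: power2_sum power_mult_distrib)
  ultimately have "\<kappa> * ((P * cos \<theta>)\<^sup>2 + (P * sin \<theta>)\<^sup>2 + h\<^sup>2) + 2 * sqrt \<kappa> * h
      = \<kappa> * P\<^sup>2 + (sqrt \<kappa> * h + 1)\<^sup>2 - 1"
    by (simp add: algebra_simps)
  then show ?thesis
    by (simp add: curved_sphere_def)
qed

text \<open>Distinct points have \<open>cos < 1\<close>. As \<open>1 - cos\<close> is at most 2, the
  product with \<open>\<kappa> * P\<^sup>2\<close> is at most 2, and excluding antipodes makes this
  strict.\<close>

lemma separated_circle_points:
  assumes "\<kappa> > 0" "\<kappa> * P\<^sup>2 \<le> 1"
    and sep: "\<And>i j. i \<noteq> j \<Longrightarrow> circle_point P h (b i) \<noteq> circle_point P h (b j)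
      \<and> \<kappa> * (dist (circle_point P h (b i)) (circle_point P h (b j)))\<^sup>2 \<noteq> 4"
  shows "separated \<kappa> P b"
  unfolding separated_def
proof (intro allI impI)
  fix i j :: 3
  assume ij: "i \<noteq> j"
  let ?c = "cos (b j - b i)"
  have "dist (circle_point P h (b i)) (circle_point P h (b j)) \<noteq> 0"
    using sep[OF ij] by simp
  then have "2 * P\<^sup>2 * (1 - ?c) \<noteq> 0"
    by (metis dist_circle_point zero_eq_power2)
  then have "?c < 1"
    using cos_le_one[of "b j - b i"] by (simp add: less_le)
  moreover have "\<kappa> * P\<^sup>2 * (1 - ?c) \<noteq> 2"
    using sep[OF ij] unfolding dist_circle_point by (simp add: algebra_simps)
  moreover have "\<kappa> * P\<^sup>2 * (1 - ?c) \<le> 1 * 2"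
    using assms cos_ge_minus_one[of "b j - b i"] by (intro mult_mono) auto
  ultimately show "?c < 1 \<and> \<kappa> * P\<^sup>2 * (1 - ?c) < 2"
    by linarith
qed

text \<open>For \<open>d > 0\<close> the cube is \<open>d\<^sup>2 powr (3/2)\<close>, so both
  factors of the denominator merge under one power whose base is a polynomial in the cosine.\<close>

lemma pair_weight_dist:
  fixes h :: real
  assumes "P > 0" "cos (b - a) < 1" "\<kappa> * P\<^sup>2 * (1 - cos (b - a)) < 2"
  defines "d \<equiv> dist (circle_point P h a) (circle_point P h b)"
  shows "1 / (d ^ 3 * (1 - \<kappa> * d\<^sup>2 / 4) powr (3/2)) = pair_weight \<kappa> P (cos (b - a))"
proof -
  have d2: "d\<^sup>2 = 2 * P\<^sup>2 * (1 - cos (b - a))"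
    unfolding d_def by (rule dist_circle_point)
  have "d\<^sup>2 > 0"
    unfolding d2 using assms by simp
  then have "d > 0"
    unfolding d_def by simp
  then have "d powr 2 = d\<^sup>2" "d powr 3 = d ^ 3"
    by (simp_all add: powr_numeral)
  moreover have "(d powr 2) powr (3/2) = d powr 3"
    unfolding powr_powr by simp
  ultimately have "d ^ 3 = d\<^sup>2 powr (3/2)"
    by metis
  moreover have "1 - \<kappa> * d\<^sup>2 / 4 \<ge> 0"
    unfolding d2 using assms(3) by (simp add: algebra_simps)
  ultimately have "d ^ 3 * (1 - \<kappa> * d\<^sup>2 / 4) powr (3/2)
      = (d\<^sup>2 * (1 - \<kappa> * d\<^sup>2 / 4)) powr (3/2)"
    by (simp only: powr_mult zero_le_power2)
  also have "d\<^sup>2 * (1 - \<kappa> * d\<^sup>2 / 4)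
      = P\<^sup>2 * (1 - cos (b - a)) * (2 - \<kappa> * P\<^sup>2 * (1 - cos (b - a)))"
    unfolding d2 by (simp add: field_simps)
  finally show ?thesis
    by (simp add: pair_weight_def)
qed

text \<open>Seen from body \<open>i\<close>, every other body differs by a part proportional to
  \<open>sin (b j - b i)\<close> and a part proportional to \<open>1 - cos (b j - b i)\<close>.
  Summing with the weights yields \<open>T\<close> and \<open>N\<close>; the curvature correction,
  proportional to the squared distance, only feeds the second part.\<close>

lemma curved_acceleration_circle_point:
  fixes h \<alpha> :: real and mass :: "3 \<Rightarrow> real" and i :: 3
  assumes "\<kappa> > 0" "P > 0" "separated \<kappa> P b"
  defines "T \<equiv> tangential_pull \<kappa> mass P b i" and "N \<equiv> radial_pull \<kappa> mass P b i"
    and "p \<equiv> \<lambda>j. circle_point P h (b j)"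
    and "v \<equiv> \<lambda>j. vector [- (\<alpha> * P) * sin (b j), \<alpha> * P * cos (b j), 0]"
  shows "curved_acceleration \<kappa> mass p v i = vector
    [P * (- sin (b i) * T - cos (b i) * ((1 - \<kappa> * P\<^sup>2) * N)) - \<kappa> * \<alpha>\<^sup>2 * P\<^sup>2 * (P * cos (b i)),
     P * (cos (b i) * T - sin (b i) * ((1 - \<kappa> * P\<^sup>2) * N)) - \<kappa> * \<alpha>\<^sup>2 * P\<^sup>2 * (P * sin (b i)),
     P\<^sup>2 * (\<kappa> * h + sqrt \<kappa>) * (N - \<alpha>\<^sup>2)]"
proof -
  define g where "g j = mass j * pair_weight \<kappa> P (cos (b j - b i))" for j
  define s where "s j = 1 - cos (b j - b i)" for j
  have "v i \<bullet> v i = (- (\<alpha> * P) * sin (b i))\<^sup>2 + (\<alpha> * P * cos (b i))\<^sup>2"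
    unfolding v_def by (simp add: inner_vec_def sum_3 power2_eq_square)
  also have "\<dots> = \<alpha>\<^sup>2 * P\<^sup>2 * ((sin (b i))\<^sup>2 + (cos (b i))\<^sup>2)"
    by algebra
  finally have "v i \<bullet> v i = \<alpha>\<^sup>2 * P\<^sup>2 * ((sin (b i))\<^sup>2 + (cos (b i))\<^sup>2)" .
  then have v: "v i \<bullet> v i = \<alpha>\<^sup>2 * P\<^sup>2"
    by simp
  have weight: "mass j / (dist (p i) (p j) ^ 3 * (1 - \<kappa> * (dist (p i) (p j))\<^sup>2 / 4) powr (3/2)) = g j"
    if "j \<in> UNIV - {i}" for j
  proof -
    have "cos (b j - b i) < 1" "\<kappa> * P\<^sup>2 * (1 - cos (b j - b i)) < 2"
      using that assms(3) unfolding separated_def by auto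
    note pair_weight_dist[OF assms(2) this, of h, symmetric]
    then show ?thesis
      by (simp add: g_def p_def)
  qed
  have d2: "(dist (p i) (p j))\<^sup>2 = 2 * P\<^sup>2 * s j" for j
    unfolding p_def s_def by (rule dist_circle_point)
  have acc: "curved_acceleration \<kappa> mass p v i = (\<Sum>j\<in>UNIV - {i}. g j *\<^sub>R
        (p j - (1 - \<kappa> * P\<^sup>2 * s j) *\<^sub>R p i + (sqrt \<kappa> * P\<^sup>2 * s j) *\<^sub>R axis 3 1))
      - (\<alpha>\<^sup>2 * P\<^sup>2) *\<^sub>R (\<kappa> *\<^sub>R p i + sqrt \<kappa> *\<^sub>R axis 3 1)"
    unfolding curved_acceleration_def v
    by (intro arg_cong2[where f = "(-)"] sum.cong refl)
      (subst weight, assumption, simp add: d2 mult.assoc)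
  have T: "T = (\<Sum>j\<in>UNIV - {i}. g j * sin (b j - b i))"
    by (simp add: T_def tangential_pull_def g_def)
  have N: "N = (\<Sum>j\<in>UNIV - {i}. g j * s j)"
    by (simp add: N_def radial_pull_def g_def s_def)
  have axis: "(axis 3 1 :: real^3) $ 1 = 0" "(axis 3 1 :: real^3) $ 2 = 0"
    "(axis 3 1 :: real^3) $ 3 = 1"
    by (simp_all add: axis_def)
  \<comment> \<open>The addition formulas for \<open>b j = b i + (b j - b i)\<close> resolve the
    position of body \<open>j\<close> along the radial and tangential directions at body
    \<open>i\<close>.\<close>
  have cosj: "cos (b j) = cos (b i) * (1 - s j) - sin (b i) * sin (b j - b i)"
    and sinj: "sin (b j) = sin (b i) * (1 - s j) + cos (b i) * sin (b j - b i)" for j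
    using cos_add[of "b i" "b j - b i"] sin_add[of "b i" "b j - b i"] by (simp_all add: s_def)
  have "curved_acceleration \<kappa> mass p v i $ 1
      = P * (- sin (b i) * T - cos (b i) * ((1 - \<kappa> * P\<^sup>2) * N)) - \<kappa> * \<alpha>\<^sup>2 * P\<^sup>2 * (P * cos (b i))"
  proof -
    have "(\<Sum>j\<in>UNIV - {i}. g j * (P * cos (b j) - (1 - \<kappa> * P\<^sup>2 * s j) * (P * cos (b i))))
        = (\<Sum>j\<in>UNIV - {i}. (- P * sin (b i)) * (g j * sin (b j - b i))
            - (P * cos (b i) * (1 - \<kappa> * P\<^sup>2)) * (g j * s j))"
      by (intro sum.cong refl, subst cosj) algebra
    also have "\<dots> = P * (- sin (b i) * T - cos (b i) * ((1 - \<kappa> * P\<^sup>2) * N))"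
      unfolding sum_subtractf sum_distrib_left[symmetric] T N by algebra
    finally show ?thesis
      unfolding acc by (simp add: axis p_def)
  qed
  moreover have "curved_acceleration \<kappa> mass p v i $ 2
      = P * (cos (b i) * T - sin (b i) * ((1 - \<kappa> * P\<^sup>2) * N)) - \<kappa> * \<alpha>\<^sup>2 * P\<^sup>2 * (P * sin (b i))"
  proof -
    have "(\<Sum>j\<in>UNIV - {i}. g j * (P * sin (b j) - (1 - \<kappa> * P\<^sup>2 * s j) * (P * sin (b i))))
        = (\<Sum>j\<in>UNIV - {i}. (P * cos (b i)) * (g j * sin (b j - b i))
            - (P * sin (b i) * (1 - \<kappa> * P\<^sup>2)) * (g j * s j))"
      by (intro sum.cong refl, subst sinj) algebra
    also have "\<dots> = P * (cos (b i) * T - sin (b i) * ((1 - \<kappa> * P\<^sup>2) * N))"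
      unfolding sum_subtractf sum_distrib_left[symmetric] T N by algebra
    finally show ?thesis
      unfolding acc by (simp add: axis p_def)
  qed
  moreover have "curved_acceleration \<kappa> mass p v i $ 3 = P\<^sup>2 * (\<kappa> * h + sqrt \<kappa>) * (N - \<alpha>\<^sup>2)"
  proof -
    have "(\<Sum>j\<in>UNIV - {i}. g j * (h - (1 - \<kappa> * P\<^sup>2 * s j) * h + sqrt \<kappa> * P\<^sup>2 * s j))
        = (\<Sum>j\<in>UNIV - {i}. (P\<^sup>2 * (\<kappa> * h + sqrt \<kappa>)) * (g j * s j))"
      by (intro sum.cong refl) algebra
    also have "\<dots> = P\<^sup>2 * (\<kappa> * h + sqrt \<kappa>) * N"
      unfolding N sum_distrib_left[symmetric] ..
    finally show ?thesis
      unfolding acc by (simp add: axis p_def algebra_simps)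
  qed
  ultimately show ?thesis
    by (simp add: vec_eq_iff forall_3)
qed

text \<open>Off the equator the vertical equation has a nonzero factor and gives the radial balance.
  The horizontal equations then add only the tangential balance, as their radial component
  follows.\<close>

lemma curved_acceleration_centripetal_iff:
  assumes "\<kappa> > 0" "P > 0" "separated \<kappa> P b" "sqrt \<kappa> * h + 1 \<noteq> 0"
  shows "curved_acceleration \<kappa> mass (\<lambda>j. circle_point P h (b j))
      (\<lambda>j. vector [- (\<alpha> * P) * sin (b j), \<alpha> * P * cos (b j), 0]) i
      = vector [- (\<alpha>\<^sup>2 * P) * cos (b i), - (\<alpha>\<^sup>2 * P) * sin (b i), 0]
    \<longleftrightarrow> tangential_pull \<kappa> mass P b i = 0 \<and> radial_pull \<kappa> mass P b i = \<alpha>\<^sup>2"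
    (is "?L \<longleftrightarrow> ?R")
proof -
  define T where "T = tangential_pull \<kappa> mass P b i"
  define N where "N = radial_pull \<kappa> mass P b i"
  let ?S = "sin (b i)" and ?C = "cos (b i)"
  have eq: "?L \<longleftrightarrow>
     P * (- ?S * T - ?C * ((1 - \<kappa> * P\<^sup>2) * N)) - \<kappa> * \<alpha>\<^sup>2 * P\<^sup>2 * (P * ?C) = - (\<alpha>\<^sup>2 * P) * ?C \<and>
     P * (?C * T - ?S * ((1 - \<kappa> * P\<^sup>2) * N)) - \<kappa> * \<alpha>\<^sup>2 * P\<^sup>2 * (P * ?S) = - (\<alpha>\<^sup>2 * P) * ?S \<and>
     P\<^sup>2 * (\<kappa> * h + sqrt \<kappa>) * (N - \<alpha>\<^sup>2) = 0"
    unfolding curved_acceleration_circle_point[OF assms(1-3)] T_def N_def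
    by (simp only: vec_eq_iff forall_3 vector_3)
  have "\<kappa> * h + sqrt \<kappa> = sqrt \<kappa> * (sqrt \<kappa> * h + 1)"
    using assms(1) by (simp add: algebra_simps)
  then have nz: "P\<^sup>2 * (\<kappa> * h + sqrt \<kappa>) \<noteq> 0"
    using assms by simp
  show ?thesis
  proof
    assume ?L
    then have *: "P * (- ?S * T - ?C * ((1 - \<kappa> * P\<^sup>2) * N)) - \<kappa> * \<alpha>\<^sup>2 * P\<^sup>2 * (P * ?C) = - (\<alpha>\<^sup>2 * P) * ?C"
      "P * (?C * T - ?S * ((1 - \<kappa> * P\<^sup>2) * N)) - \<kappa> * \<alpha>\<^sup>2 * P\<^sup>2 * (P * ?S) = - (\<alpha>\<^sup>2 * P) * ?S"
      and "N = \<alpha>\<^sup>2"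
      unfolding eq using nz by auto
    \<comment> \<open>Projection of the two horizontal equations on the tangent direction
      \<open>(- ?S, ?C)\<close>, in which all radial terms cancel.\<close>
    have "P * (T * (?S\<^sup>2 + ?C\<^sup>2)) = 0"
      using * by algebra
    then have "T = 0"
      using assms(2) by simp
    then show ?R
      using \<open>N = \<alpha>\<^sup>2\<close> by (simp add: T_def N_def)
  next
    assume ?R
    then have "T = 0" "N = \<alpha>\<^sup>2"
      by (simp_all add: T_def N_def)
    then show ?L
      unfolding eq by (simp add: algebra_simps)
  qed
qed

section \<open>Uniform rotations as solutions of the equations of motion\<close>

lemma vector_3_axis:
  "(vector [x, y, z] :: real^3) = x *\<^sub>R axis 1 1 + y *\<^sub>R axis 2 1 + z *\<^sub>R axis 3 1"
  by (simp add: vec_eq_iff forall_3 axis_def)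

lemma has_vector_derivative_circle_point:
  "((\<lambda>t. circle_point P h (\<alpha> * t + a)) has_vector_derivative
     vector [- (\<alpha> * P) * sin (\<alpha> * t + a), \<alpha> * P * cos (\<alpha> * t + a), 0]) (at t)"
  unfolding circle_point_def vector_3_axis
  by (auto intro!: derivative_eq_intros simp: algebra_simps)

lemma has_vector_derivative_circle_velocity:
  "((\<lambda>t. vector [- (\<alpha> * P) * sin (\<alpha> * t + a), \<alpha> * P * cos (\<alpha> * t + a), 0] :: real^3)
     has_vector_derivative
     vector [- (\<alpha>\<^sup>2 * P) * cos (\<alpha> * t + a), - (\<alpha>\<^sup>2 * P) * sin (\<alpha> * t + a), 0]) (at t)"
  unfolding vector_3_axis
  by (auto intro!: derivative_eq_intros simp: power2_eq_square algebra_simps)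

text \<open>Only phase differences enter, so these quantities stay constant along a rigid rotation
  and can be checked at the initial phases.\<close>

lemma tangential_pull_shift: "tangential_pull \<kappa> mass P (\<lambda>j. c + b j) i = tangential_pull \<kappa> mass P b i"
  and radial_pull_shift: "radial_pull \<kappa> mass P (\<lambda>j. c + b j) i = radial_pull \<kappa> mass P b i"
  and separated_shift: "separated \<kappa> P (\<lambda>j. c + b j) \<longleftrightarrow> separated \<kappa> P b"
  by (simp_all add: tangential_pull_def radial_pull_def separated_def)

text \<open>Uniqueness of derivatives identifies the velocity field of the solution with that of the
  rotation. Comparing accelerations at time 0 then gives both balances.\<close>

lemma curved_solution_rotatingD:
  assumes "\<kappa> > 0" "P > 0" "sqrt \<kappa> * h + 1 \<noteq> 0"
    and q: "\<And>i t. q i t = circle_point P h (\<alpha> * t + a i)"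
    and sol: "curved_solution \<kappa> mass q"
  shows "\<kappa> * P\<^sup>2 + (sqrt \<kappa> * h + 1)\<^sup>2 = 1" "separated \<kappa> P a"
    "tangential_pull \<kappa> mass P a i = 0" "radial_pull \<kappa> mass P a i = \<alpha>\<^sup>2"
proof -
  have "circle_point P h (\<alpha> * 0 + a 1) \<in> curved_sphere \<kappa>"
    using sol unfolding curved_solution_def q by blast
  then show sphere: "\<kappa> * P\<^sup>2 + (sqrt \<kappa> * h + 1)\<^sup>2 = 1"
    unfolding circle_point_in_curved_sphere[OF assms(1)] .
  then have le: "\<kappa> * P\<^sup>2 \<le> 1"
    by (smt (verit) zero_le_power2)
  have ne: "q i 0 \<noteq> q j 0 \<and> \<kappa> * (dist (q i 0) (q j 0))\<^sup>2 \<noteq> 4" if "i \<noteq> j" for i j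
    using sol that unfolding curved_solution_def by blast
  show sep: "separated \<kappa> P a"
    using separated_circle_points[OF assms(1) le, of h a] ne unfolding q by simp
  obtain v where v: "\<And>i t. (q i has_vector_derivative v i t) (at t)"
    and acc: "\<And>i t. (v i has_vector_derivative
           curved_acceleration \<kappa> mass (\<lambda>j. q j t) (\<lambda>j. v j t) i) (at t)"
    using sol unfolding curved_solution_def by blast
  have v_eq: "v i = (\<lambda>t. vector [- (\<alpha> * P) * sin (\<alpha> * t + a i), \<alpha> * P * cos (\<alpha> * t + a i), 0])" for i
  proof
    fix t
    have "(q i has_vector_derivative
        vector [- (\<alpha> * P) * sin (\<alpha> * t + a i), \<alpha> * P * cos (\<alpha> * t + a i), 0]) (at t)"
      using has_vector_derivative_circle_point[of P h \<alpha> "a i" t] q[of i] by presburger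
    then show "v i t = vector [- (\<alpha> * P) * sin (\<alpha> * t + a i), \<alpha> * P * cos (\<alpha> * t + a i), 0]"
      using v vector_derivative_unique_at by blast
  qed
  have "curved_acceleration \<kappa> mass (\<lambda>j. q j 0) (\<lambda>j. v j 0) i
      = vector [- (\<alpha>\<^sup>2 * P) * cos (\<alpha> * 0 + a i), - (\<alpha>\<^sup>2 * P) * sin (\<alpha> * 0 + a i), 0]"
    using acc[of i 0] has_vector_derivative_circle_velocity[of \<alpha> P "a i" 0]
      vector_derivative_unique_at unfolding v_eq[of i] by blast
  then show "tangential_pull \<kappa> mass P a i = 0" "radial_pull \<kappa> mass P a i = \<alpha>\<^sup>2"
    using curved_acceleration_centripetal_iff[OF assms(1,2) sep assms(3), of mass \<alpha> i]
    by (simp_all add: q v_eq)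
qed

lemma curved_solution_rotatingI:
  assumes "\<kappa> > 0" "P > 0" "sqrt \<kappa> * h + 1 \<noteq> 0"
    and sphere: "\<kappa> * P\<^sup>2 + (sqrt \<kappa> * h + 1)\<^sup>2 = 1"
    and sep: "separated \<kappa> P a"
    and pull: "\<And>i. tangential_pull \<kappa> mass P a i = 0" "\<And>i. radial_pull \<kappa> mass P a i = \<alpha>\<^sup>2"
  shows "curved_solution \<kappa> mass (\<lambda>i t. circle_point P h (\<alpha> * t + a i))"
  unfolding curved_solution_def
proof (intro conjI allI impI exI)
  fix i j :: 3 and t :: real
  show "circle_point P h (\<alpha> * t + a i) \<in> curved_sphere \<kappa>"
    using circle_point_in_curved_sphere[OF assms(1)] sphere by blast
  show "((\<lambda>t. circle_point P h (\<alpha> * t + a i)) has_vector_derivative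
     vector [- (\<alpha> * P) * sin (\<alpha> * t + a i), \<alpha> * P * cos (\<alpha> * t + a i), 0]) (at t)"
    by (rule has_vector_derivative_circle_point)
  have "curved_acceleration \<kappa> mass (\<lambda>j. circle_point P h (\<alpha> * t + a j))
      (\<lambda>j. vector [- (\<alpha> * P) * sin (\<alpha> * t + a j), \<alpha> * P * cos (\<alpha> * t + a j), 0]) i
    = vector [- (\<alpha>\<^sup>2 * P) * cos (\<alpha> * t + a i), - (\<alpha>\<^sup>2 * P) * sin (\<alpha> * t + a i), 0]"
    using curved_acceleration_centripetal_iff[OF assms(1,2) _ assms(3), of "\<lambda>j. \<alpha> * t + a j" mass \<alpha> i]
      sep pull[of i] by (simp only: tangential_pull_shift radial_pull_shift separated_shift)
  then show "((\<lambda>t. vector [- (\<alpha> * P) * sin (\<alpha> * t + a i), \<alpha> * P * cos (\<alpha> * t + a i), 0])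
     has_vector_derivative curved_acceleration \<kappa> mass (\<lambda>j. circle_point P h (\<alpha> * t + a j))
      (\<lambda>j. vector [- (\<alpha> * P) * sin (\<alpha> * t + a j), \<alpha> * P * cos (\<alpha> * t + a j), 0]) i) (at t)"
    using has_vector_derivative_circle_velocity by simp
  assume "i \<noteq> j"
  then have c: "cos (a j - a i) < 1" "\<kappa> * P\<^sup>2 * (1 - cos (a j - a i)) < 2"
    using sep unfolding separated_def by blast+
  have d: "(dist (circle_point P h (\<alpha> * t + a i)) (circle_point P h (\<alpha> * t + a j)))\<^sup>2
      = 2 * P\<^sup>2 * (1 - cos (a j - a i))"
    by (simp add: dist_circle_point)
  then show "circle_point P h (\<alpha> * t + a i) \<noteq> circle_point P h (\<alpha> * t + a j)"
    using c(1) assms(2) by auto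
  show "\<kappa> * (dist (circle_point P h (\<alpha> * t + a i)) (circle_point P h (\<alpha> * t + a j)))\<^sup>2 \<noteq> 4"
    unfolding d using c(2) by (simp add: algebra_simps)
qed

subsection \<open>Three bodies, two of equal mass\<close>

lemma sum_other_3:
  "sum f (UNIV - {1::3}) = f 2 + f 3"
  "sum f (UNIV - {2::3}) = f 1 + f 3"
  "sum f (UNIV - {3::3}) = f 1 + f 2"
proof -
  have "UNIV - {1::3} = {2, 3}" "UNIV - {2::3} = {1, 3}" "UNIV - {3::3} = {1, 2}"
    using exhaust_3 by auto
  then show "sum f (UNIV - {1::3}) = f 2 + f 3" "sum f (UNIV - {2::3}) = f 1 + f 3"
    "sum f (UNIV - {3::3}) = f 1 + f 2"
    by simp_all
qed

text \<open>Since \<open>sin u / (1 - cos u)\<close> is the cotangent of \<open>u / 2\<close>, the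
  hypothesis says that the half angles are opposite modulo \<pi>, that is \<open>u = - v\<close>
  modulo a full turn.\<close>

lemma cos_sin_from_half_angle_cot:
  fixes u v :: real
  assumes "cos u < 1" "cos v < 1" "sin u * (1 - cos v) = - (sin v * (1 - cos u))"
  shows "cos u = cos v" "sin u = - sin v"
proof -
  have "(sin u * (1 - cos v))\<^sup>2 = (sin v * (1 - cos u))\<^sup>2"
    using assms(3) by simp
  then have "(1 - (cos u)\<^sup>2) * (1 - cos v)\<^sup>2 = (1 - (cos v)\<^sup>2) * (1 - cos u)\<^sup>2"
    by (simp add: power_mult_distrib sin_squared_eq)
  then have "(1 - cos u) * ((1 - cos v) * (2 * (cos u - cos v))) = 0"
    by algebra
  then show c: "cos u = cos v"
    using assms by simp
  have "(sin u + sin v) * (1 - cos v) = 0"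
    using assms(3) unfolding c by algebra
  then show "sin u = - sin v"
    using assms by simp
qed

lemma pair_weight_pos:
  assumes "P > 0" "c < 1" "\<kappa> * P\<^sup>2 * (1 - c) < 2"
  shows "pair_weight \<kappa> P c > 0"
  using assms by (simp add: pair_weight_def)

text \<open>With \<open>s = \<kappa> * P\<^sup>2 * (1 - c)\<close>, the base of the power is
  \<open>s * (2 - s) / \<kappa>\<close>, a parabola symmetric about \<open>s = 1\<close>. Here
  \<open>s\<close> is 1 minus the cosine of the geodesic distance in units of the radius of the
  sphere, so equal weights mean equal or supplementary distances.\<close>

lemma pair_weight_eqD:
  assumes "P > 0" "c < 1" "\<kappa> * P\<^sup>2 * (1 - c) < 2" "d < 1" "\<kappa> * P\<^sup>2 * (1 - d) < 2"
    and eq: "pair_weight \<kappa> P c = pair_weight \<kappa> P d"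
  shows "c = d \<or> \<kappa> * P\<^sup>2 * (2 - c - d) = 2"
proof -
  let ?E = "\<lambda>c. P\<^sup>2 * (1 - c) * (2 - \<kappa> * P\<^sup>2 * (1 - c))"
  have pos: "?E c > 0" "?E d > 0"
    using assms by simp_all
  have "?E c powr (3/2) = ?E d powr (3/2)"
    using eq pos by (simp add: pair_weight_def)
  then have "?E c = ?E d"
    using pos by (metis less_eq_real_def powr_less_mono2 zero_less_divide_iff zero_less_numeral
        linorder_neqE_linordered_idom order_less_irrefl)
  then have "P\<^sup>2 * ((d - c) * (2 - \<kappa> * P\<^sup>2 * (2 - c - d))) = 0"
    by algebra
  then show ?thesis
    using assms by auto
qed

text \<open>The radial balances of the equal masses and the tangential balance of body 1 show that
  body 1 is the apex of an isosceles triangle. The tangential balance of body 2, with the radial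
  balances of bodies 1 and 2, then forces equal weights and fixes \<open>x\<close>. Equal weights
  without equal sides leave the supplementary case.\<close>

lemma balance_imp_shape:
  fixes a :: "3 \<Rightarrow> real"
  assumes "P > 0" "M > 0" "m > 0" "separated \<kappa> P a"
    and tan: "\<And>i. tangential_pull \<kappa> (\<lambda>i. if i = 1 then M else m) P a i = 0"
    and rad: "\<And>i. radial_pull \<kappa> (\<lambda>i. if i = 1 then M else m) P a i = \<alpha>\<^sup>2"
    and not_eq: "\<not> (cos (a 2 - a 1) = cos (a 3 - a 1) \<and> cos (a 2 - a 1) = cos (a 3 - a 2))"
  defines "x \<equiv> - M / (2 * m)"
  shows "cos (a 2 - a 1) = x" "cos (a 3 - a 1) = x" "sin (a 2 - a 1) = - sin (a 3 - a 1)"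
    "- 1 < x" "x \<noteq> - 1 / 2" "\<kappa> * P\<^sup>2 * ((1 - x) * (3 + 2 * x)) = 2"
    "\<alpha>\<^sup>2 = 2 * m * (1 - x) * pair_weight \<kappa> P x"
proof -
  have flip: "cos (s - t) = cos (t - s)" "sin (s - t) = - sin (t - s)" for s t :: real
    by (metis cos_minus minus_diff_eq, metis sin_minus minus_diff_eq)
  define u where "u = a 2 - a 1"
  define v where "v = a 3 - a 1"
  define g where "g i j = pair_weight \<kappa> P (cos (a j - a i))" for i j
  have w: "a 3 - a 2 = v - u" "a 2 - a 3 = u - v" "a 1 - a 2 = - u" "a 1 - a 3 = - v"
    by (simp_all add: u_def v_def)
  have sep: "cos (a j - a i) < 1" "\<kappa> * P\<^sup>2 * (1 - cos (a j - a i)) < 2" if "i \<noteq> j" for i j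
    using assms(4) that unfolding separated_def by blast+
  have "(1::3) \<noteq> 2" "(1::3) \<noteq> 3" "(2::3) \<noteq> 3"
    by simp_all
  note sep = sep[OF this(1)] sep[OF this(2)] sep[OF this(3)]
  have g_pos: "g 1 2 > 0" "g 1 3 > 0" "g 2 3 > 0"
    unfolding g_def using sep by (auto intro!: pair_weight_pos assms(1))
  have g_sym: "g 2 1 = g 1 2" "g 3 1 = g 1 3" "g 3 2 = g 2 3"
    by (simp_all add: g_def flip(1)[of "a 1"] flip(1)[of "a 2" "a 3"])
  have tan1: "m * g 1 2 * sin u + m * g 1 3 * sin v = 0"
    using tan[of 1] by (simp add: tangential_pull_def sum_other_3 g_def u_def v_def)
  have tan2: "M * g 2 1 * sin (- u) + m * g 2 3 * sin (v - u) = 0"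
    using tan[of 2] by (simp add: tangential_pull_def sum_other_3 g_def flip: w)
  have rad1: "m * g 1 2 * (1 - cos u) + m * g 1 3 * (1 - cos v) = \<alpha>\<^sup>2"
    using rad[of 1] by (simp add: radial_pull_def sum_other_3 g_def u_def v_def)
  have rad2: "M * g 2 1 * (1 - cos (- u)) + m * g 2 3 * (1 - cos (v - u)) = \<alpha>\<^sup>2"
    using rad[of 2] by (simp add: radial_pull_def sum_other_3 g_def flip: w)
  have rad3: "M * g 3 1 * (1 - cos (- v)) + m * g 3 2 * (1 - cos (u - v)) = \<alpha>\<^sup>2"
    using rad[of 3] by (simp add: radial_pull_def sum_other_3 g_def flip: w)
  have uv: "cos u < 1" "cos v < 1" "cos (v - u) < 1"
    using sep by (simp_all add: u_def v_def)
  \<comment> \<open>Subtracting the radial balances of bodies 2 and 3 cancels their mutual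
    attraction.\<close>
  have "M * (g 1 2 * (1 - cos u) - g 1 3 * (1 - cos v)) = 0"
    using rad2 rad3 by (simp add: g_sym flip(1)[of u v] algebra_simps)
  then have F: "g 1 2 * (1 - cos u) = g 1 3 * (1 - cos v)"
    using assms(2) by simp
  have "m * (g 1 2 * sin u + g 1 3 * sin v) = 0"
    using tan1 by algebra
  then have A: "g 1 2 * sin u = - (g 1 3 * sin v)"
    using assms(3) by simp
  \<comment> \<open>Multiplying \<open>F\<close> and \<open>A\<close> crosswise isolates the weights
    as a nonzero common factor, leaving a relation between the angles alone.\<close>
  have "g 1 2 * g 1 3 * (sin u * (1 - cos v) + sin v * (1 - cos u)) = 0"
    using F A by algebra
  then have "sin u * (1 - cos v) = - (sin v * (1 - cos u))"
    using g_pos by simp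
  note cs = cos_sin_from_half_angle_cot[OF uv(1,2) this]
  define c where "c = cos u"
  have cv: "cos v = c"
    using cs(1) by (simp add: c_def)
  have sv: "sin v = - sin u"
    using cs(2) by simp
  have su2: "(sin u)\<^sup>2 = 1 - c\<^sup>2"
    by (simp add: c_def sin_squared_eq)
  have cvu: "cos (v - u) = 2 * c\<^sup>2 - 1"
    using su2 by (simp add: cos_diff cv sv c_def[symmetric] power2_eq_square)
  have svu: "sin (v - u) = - (2 * c * sin u)"
    by (simp add: sin_diff cv sv c_def[symmetric])
  \<comment> \<open>Otherwise \<open>c\<^sup>2 = 1\<close> and \<open>cos (v - u) = 1\<close>, a
    collision of bodies 2 and 3.\<close>
  have "sin u \<noteq> 0"
    using uv(3) su2 cvu by auto
  have g12_13: "g 1 2 = g 1 3"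
    by (simp add: g_def cs(1) flip: u_def v_def)
  have "sin u * (M * g 1 2 + 2 * m * c * g 2 3) = 0"
    using tan2 by (simp add: g_sym svu algebra_simps)
  then have t: "M * g 1 2 = - (2 * m * c * g 2 3)"
    using \<open>sin u \<noteq> 0\<close> by simp
  have r: "2 * m * g 1 2 * (1 - c) = M * g 1 2 * (1 - c) + m * g 2 3 * (2 - 2 * c\<^sup>2)"
    using rad1 rad2 by (simp add: g_sym g12_13 cvu cv algebra_simps flip: c_def)
  \<comment> \<open>Eliminating \<open>M * g 1 2\<close> from \<open>r\<close> by \<open>t\<close>
    cancels the terms in \<open>c * g 2 3\<close> inside the common factor
    \<open>1 - c\<close>.\<close>
  have "2 * m * (1 - c) * (g 1 2 - g 2 3) = 0"
    using r t by algebra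
  then have g23: "g 1 2 = g 2 3"
    using assms(3) uv(1) by (simp add: c_def)
  have "M = - (2 * m * c)"
  proof -
    have "(M + 2 * m * c) * g 2 3 = 0"
      using t unfolding g23 by algebra
    then show ?thesis
      using g_pos(3) by simp
  qed
  then have xc: "x = c"
    using assms(3) by (simp add: x_def)
  have cos_eqs: "cos (a 2 - a 1) = c" "cos (a 3 - a 1) = c" "cos (a 3 - a 2) = 2 * c\<^sup>2 - 1"
    by (simp add: c_def u_def, simp add: cv flip: v_def, simp add: w cvu)
  show "cos (a 2 - a 1) = x" "cos (a 3 - a 1) = x"
    by (simp_all add: xc cos_eqs)
  show "sin (a 2 - a 1) = - sin (a 3 - a 1)"
    by (simp add: sv flip: u_def v_def)
  have ne: "c \<noteq> 2 * c\<^sup>2 - 1"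
    using not_eq by (simp add: cos_eqs)
  have "- 1 \<le> c"
    by (simp add: c_def)
  moreover have "c \<noteq> - 1"
    using \<open>sin u \<noteq> 0\<close> su2 by auto
  ultimately show "- 1 < x"
    by (simp add: xc)
  show "x \<noteq> - 1 / 2"
    using ne by (auto simp: xc power2_eq_square)
  have "c = 2 * c\<^sup>2 - 1 \<or> \<kappa> * P\<^sup>2 * (2 - c - (2 * c\<^sup>2 - 1)) = 2"
    using pair_weight_eqD[OF assms(1) sep(1,2,5,6)] g23 unfolding g_def cos_eqs by blast
  with ne have "\<kappa> * P\<^sup>2 * (2 - c - (2 * c\<^sup>2 - 1)) = 2"
    by blast
  then show "\<kappa> * P\<^sup>2 * ((1 - x) * (3 + 2 * x)) = 2"
    by (simp add: xc power2_eq_square algebra_simps)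
  show "\<alpha>\<^sup>2 = 2 * m * (1 - x) * pair_weight \<kappa> P x"
    using rad1 by (simp add: g12_13 cv xc flip: c_def) (simp add: g_def cos_eqs)
qed

section \<open>Isosceles relative equilibria described by the cosine at the apex\<close>

lemma dist_circle_point_eq_iff:
  assumes "P > 0"
  shows "dist (circle_point P h a) (circle_point P h b) = dist (circle_point P h c) (circle_point P h d)
    \<longleftrightarrow> cos (b - a) = cos (d - c)"
proof -
  have "dist (circle_point P h a) (circle_point P h b) = dist (circle_point P h c) (circle_point P h d)
    \<longleftrightarrow> 2 * P\<^sup>2 * (1 - cos (b - a)) = 2 * P\<^sup>2 * (1 - cos (d - c))"
    unfolding dist_circle_point[of P h, symmetric]
    by (rule power2_eq_iff_nonneg[OF zero_le_dist zero_le_dist, symmetric])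
  then show ?thesis
    using assms by simp
qed

text \<open>As a set, the triangle does not record which of the two equal masses sits at which base
  vertex.\<close>

definition apex_triangle :: "real \<Rightarrow> real \<Rightarrow> real \<Rightarrow> real \<Rightarrow> (real^3) set" where
  "apex_triangle P h x b =
     {circle_point P h b, circle_point P h (b + arccos x), circle_point P h (b - arccos x)}"

text \<open>The factor \<open>sqrt \<kappa> * h + 1\<close> is the height over the plane of the equator in units of the radius of
  the sphere. Only the sign of \<open>x\<close> remains of the positivity of the masses.\<close>

definition RE_circle :: "real \<Rightarrow> real \<Rightarrow> real \<Rightarrow> real \<Rightarrow> bool" where
  "RE_circle \<kappa> P h x \<longleftrightarrow> 0 < P \<and> \<kappa> * P\<^sup>2 + (sqrt \<kappa> * h + 1)\<^sup>2 = 1 \<and>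
     - 1 < x \<and> x < 0 \<and> x \<noteq> - 1 / 2 \<and> \<kappa> * P\<^sup>2 * ((1 - x) * (3 + 2 * x)) = 2"

text \<open>The cosine determines the sine up to sign. As the two sines are opposite, either choice
  of sign gives the same unordered pair.\<close>

lemma circle_point_pair:
  assumes "cos u = x" "cos v = x" "sin u = - sin v" "-1 \<le> x" "x \<le> 1"
  shows "{circle_point P h (b + u), circle_point P h (b + v)}
    = {circle_point P h (b + arccos x), circle_point P h (b - arccos x)}"
proof -
  have "(sin u)\<^sup>2 = (sqrt (1 - x\<^sup>2))\<^sup>2"
    using assms by (simp add: sin_squared_eq abs_square_le_1 abs_le_iff)
  then have "sin u = sin (arccos x) \<or> sin u = - sin (arccos x)"
    using assms by (auto simp: sin_arccos power2_eq_iff)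
  then have "sin u = sin (arccos x) \<and> sin v = - sin (arccos x)
      \<or> sin u = - sin (arccos x) \<and> sin v = sin (arccos x)"
    using assms(3) by linarith
  moreover have "cos (arccos x) = x"
    using assms by simp
  ultimately show ?thesis
    using assms(1,2)
    by (auto simp: circle_point_def cos_add sin_add cos_diff sin_diff simp del: cos_arccos sin_arccos)
qed

text \<open>At a common height the equation of the sphere forces equal radii, and the absence of
  collisions makes them positive. Thus the motion is a rigid rotation on one circle, to which the
  balance equations apply.\<close>

lemma isosceles_RE_D:
  assumes "\<kappa> > 0" "M > 0" "m > 0" "h \<noteq> - 1 / sqrt \<kappa>" "isosceles_RE \<kappa> M m \<alpha> h q"
  defines "x \<equiv> - M / (2 * m)"
  obtains P b where "RE_circle \<kappa> P h x" "\<alpha>\<^sup>2 = 2 * m * (1 - x) * pair_weight \<kappa> P x"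
    "\<forall>t. range (\<lambda>i. q i t) = apex_triangle P h x (\<alpha> * t + b)"
proof -
  let ?mass = "\<lambda>i::3. if i = 1 then M else m"
  have sol: "curved_solution \<kappa> ?mass q" and ht: "\<And>i t. q i t $ 3 = h"
    and ne: "\<not> equilateral (\<lambda>i. q i 0)"
    and "\<forall>i. \<exists>\<rho> a z. \<rho> \<ge> 0 \<and> (\<forall>t. q i t = vector [\<rho> * cos (\<alpha> * t + a), \<rho> * sin (\<alpha> * t + a), z])"
    using assms(5) unfolding isosceles_RE_def relative_equilibrium_at_height_def
      relative_equilibrium_def by blast+
  then obtain \<rho> a z where \<rho>: "\<And>i. \<rho> i \<ge> 0"
    and q': "\<And>i t. q i t = vector [\<rho> i * cos (\<alpha> * t + a i), \<rho> i * sin (\<alpha> * t + a i), z i]"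
    by metis
  have "z i = h" for i
    using ht[of i 0] by (simp add: q')
  then have q_\<rho>: "q i t = circle_point (\<rho> i) h (\<alpha> * t + a i)" for i t
    by (simp add: q' circle_point_def)
  define P where "P = \<rho> 1"
  have "q i 0 \<in> curved_sphere \<kappa>" for i
    using sol unfolding curved_solution_def by blast
  then have sph: "\<kappa> * (\<rho> i)\<^sup>2 + (sqrt \<kappa> * h + 1)\<^sup>2 = 1" for i
    unfolding q_\<rho> circle_point_in_curved_sphere[OF assms(1)] .
  have "\<kappa> * (\<rho> i)\<^sup>2 = \<kappa> * P\<^sup>2" for i
    using sph[of i] sph[of 1] unfolding P_def by linarith
  then have "\<rho> i = P" for i
    using assms(1) \<rho> by (simp add: P_def power2_eq_iff_nonneg)
  then have q: "q i t = circle_point P h (\<alpha> * t + a i)" for i t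
    by (simp add: q_\<rho>)
  have "(1::3) \<noteq> 2"
    by simp
  have "P \<noteq> 0"
  proof
    assume "P = 0"
    then have "q 1 0 = q 2 0"
      by (simp add: q circle_point_def)
    then show False
      using sol unfolding curved_solution_def by (metis \<open>(1::3) \<noteq> 2\<close>)
  qed
  then have "P > 0"
    using \<rho>[of 1] by (simp add: P_def)
  have Z: "sqrt \<kappa> * h + 1 \<noteq> 0"
    using assms(1,4) by (simp add: field_simps add_eq_0_iff)
  note D = curved_solution_rotatingD[OF assms(1) \<open>P > 0\<close> Z q sol]
  have "\<not> (cos (a 2 - a 1) = cos (a 3 - a 1) \<and> cos (a 2 - a 1) = cos (a 3 - a 2))"
  proof
    assume *: "cos (a 2 - a 1) = cos (a 3 - a 1) \<and> cos (a 2 - a 1) = cos (a 3 - a 2)"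
    have flip: "cos (s - t) = cos (t - s)" for s t :: real
      by (metis cos_minus minus_diff_eq)
    have "dist (q i 0) (q j 0) = dist (q 1 0) (q 2 0)" if "i \<noteq> j" for i j
    proof -
      have "cos (a j - a i) = cos (a 2 - a 1)"
        using exhaust_3[of i] exhaust_3[of j] that * flip[of "a 1" "a 2"] flip[of "a 1" "a 3"]
          flip[of "a 2" "a 3"]
        by (elim disjE) simp_all
      then show ?thesis
        unfolding q dist_circle_point_eq_iff[OF \<open>P > 0\<close>] by simp
    qed
    then show False
      using ne unfolding equilateral_def by blast
  qed
  note shape = balance_imp_shape[OF \<open>P > 0\<close> assms(2,3) D(2-4) this, folded x_def]
  have "x < 0"
    using assms(2,3) by (simp add: x_def)
  then have "RE_circle \<kappa> P h x"
    unfolding RE_circle_def using \<open>P > 0\<close> D(1) shape(4-6) by blast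
  moreover have "range (\<lambda>i. q i t) = apex_triangle P h x (\<alpha> * t + a 1)" for t
  proof -
    let ?b = "\<alpha> * t + a 1"
    have "range (\<lambda>i. q i t) = {q 1 t, q 2 t, q 3 t}"
      unfolding UNIV_3 by simp
    also have "\<dots> = insert (circle_point P h ?b)
        {circle_point P h (?b + (a 2 - a 1)), circle_point P h (?b + (a 3 - a 1))}"
      by (simp add: q)
    also have "\<dots> = apex_triangle P h x ?b"
      using circle_point_pair[OF shape(1-3), of P h ?b] shape(4) \<open>x < 0\<close>
      by (simp add: apex_triangle_def)
    finally show ?thesis .
  qed
  ultimately show thesis
    using that shape(7) by blast
qed

text \<open>The shape equation makes the weights of base and leg equal. With
  \<open>- 2 * m * x\<close> as the mass at the apex, both balances become trigonometric identities,
  and the radial one dictates the choice of \<alpha>.\<close>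

lemma isosceles_RE_exists:
  assumes "\<kappa> > 0" "m > 0" "h \<noteq> - 1 / sqrt \<kappa>" "RE_circle \<kappa> P h x"
  obtains \<alpha> q where "isosceles_RE \<kappa> (- 2 * m * x) m \<alpha> h q"
    "range (\<lambda>i. q i 0) = apex_triangle P h x 0"
proof -
  define a :: "3 \<Rightarrow> real" where
    "a i = (if i = 1 then 0 else if i = 2 then arccos x else - arccos x)" for i
  let ?mass = "\<lambda>i::3. if i = 1 then - 2 * m * x else m"
  define \<alpha> where "\<alpha> = sqrt (2 * m * (1 - x) * pair_weight \<kappa> P x)"
  define q where "q i t = circle_point P h (\<alpha> * t + a i)" for i t
  have a_simps [simp]: "a 1 = 0" "a 2 = arccos x" "a 3 = - arccos x"
    by (simp_all add: a_def)
  have "P > 0" and sph: "\<kappa> * P\<^sup>2 + (sqrt \<kappa> * h + 1)\<^sup>2 = 1"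
    and x: "- 1 < x" "x < 0" "x \<noteq> - 1 / 2"
    and shape: "\<kappa> * P\<^sup>2 * ((1 - x) * (3 + 2 * x)) = 2"
    using assms(4) unfolding RE_circle_def by blast+
  have Z: "sqrt \<kappa> * h + 1 \<noteq> 0"
    using assms(1,3) by (simp add: field_simps add_eq_0_iff)
  have "\<bar>x\<bar> \<le> 1"
    using x by simp
  then have x2: "x\<^sup>2 < 1"
    using x by (simp add: abs_square_less_1)
  have cosx: "cos (arccos x) = x"
    using x by simp
  have cos2: "cos (2 * arccos x) = 2 * x\<^sup>2 - 1"
    and sin2: "sin (2 * arccos x) = 2 * x * sin (arccos x)"
    unfolding cos_double_cos sin_double cosx by simp_all
  have s1: "\<kappa> * P\<^sup>2 * (1 - x) < 2"
  proof -
    have pos: "\<kappa> * P\<^sup>2 * (1 - x) > 0"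
      using assms(1) \<open>P > 0\<close> x by simp
    have "\<kappa> * P\<^sup>2 * (1 - x) * 1 < \<kappa> * P\<^sup>2 * (1 - x) * (3 + 2 * x)"
      using pos x by (intro mult_strict_left_mono) auto
    then show ?thesis
      using shape by (simp add: mult.assoc)
  qed
  \<comment> \<open>The shape equation in the form that base and leg have supplementary geodesic
    distances: \<open>s\<close> for the base is \<open>2 - s\<close> for the leg, and
    \<open>s * (2 - s)\<close> is symmetric.\<close>
  have s_sum: "\<kappa> * P\<^sup>2 * (1 - (2 * x\<^sup>2 - 1)) = 2 - \<kappa> * P\<^sup>2 * (1 - x)"
    using shape by (simp add: algebra_simps power2_eq_square)
  have s2: "\<kappa> * P\<^sup>2 * (1 - (2 * x\<^sup>2 - 1)) < 2"
    unfolding s_sum using assms(1) \<open>P > 0\<close> x by simp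
  have sep: "separated \<kappa> P a"
    unfolding separated_def forall_3
    using x x2 s1 s2 by (simp add: cosx cos2)
  have "(1 - x) * (2 - \<kappa> * P\<^sup>2 * (1 - x)) =
      (1 - (2 * x\<^sup>2 - 1)) * (2 - \<kappa> * P\<^sup>2 * (1 - (2 * x\<^sup>2 - 1)))"
    unfolding s_sum using s_sum by algebra
  then have weight: "pair_weight \<kappa> P (2 * x\<^sup>2 - 1) = pair_weight \<kappa> P x"
    unfolding pair_weight_def mult.assoc by simp
  have gpos: "pair_weight \<kappa> P x > 0"
    using pair_weight_pos[OF \<open>P > 0\<close> _ s1] x by simp
  then have \<alpha>2: "\<alpha>\<^sup>2 = 2 * m * (1 - x) * pair_weight \<kappa> P x" and "\<alpha> > 0"
    using assms(2) x by (simp_all add: \<alpha>_def)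
  have "\<forall>i. tangential_pull \<kappa> ?mass P a i = 0"
    unfolding forall_3 tangential_pull_def sum_other_3
    by (simp add: cosx cos2 sin2 weight)
  moreover have "\<forall>i. radial_pull \<kappa> ?mass P a i = \<alpha>\<^sup>2"
    unfolding forall_3 radial_pull_def sum_other_3 \<alpha>2
    by (simp add: cosx cos2 sin2 weight) (simp add: algebra_simps power2_eq_square)
  ultimately have sol: "curved_solution \<kappa> ?mass q"
    unfolding q_def using curved_solution_rotatingI[OF assms(1) \<open>P > 0\<close> Z sph sep] by blast
  have "relative_equilibrium \<kappa> ?mass \<alpha> q"
    unfolding relative_equilibrium_def
    using sol \<open>\<alpha> > 0\<close> \<open>P > 0\<close> unfolding q_def circle_point_def
    by (metis less_eq_real_def less_irrefl)
  moreover have "isosceles (\<lambda>i. q i t)" for t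
    unfolding isosceles_def q_def dist_circle_point_eq_iff[OF \<open>P > 0\<close>]
    by (intro exI[of _ 1] exI[of _ 2] exI[of _ 3]) simp
  moreover have "\<not> equilateral (\<lambda>i. q i t)" for t
  proof
    assume "equilateral (\<lambda>i. q i t)"
    then obtain s where "\<And>i j. i \<noteq> j \<Longrightarrow> dist (q i t) (q j t) = s"
      unfolding equilateral_def by blast
    from this[of 1 2] this[of 2 3] have "dist (q 1 t) (q 2 t) = dist (q 2 t) (q 3 t)"
      by simp
    then have "x = 2 * x\<^sup>2 - 1"
      unfolding q_def dist_circle_point_eq_iff[OF \<open>P > 0\<close>] by (simp add: cosx cos2)
    then have "(x - 1) * (2 * x + 1) = 0"
      by algebra
    then show False
      using x by auto
  qed
  ultimately have "isosceles_RE \<kappa> (- 2 * m * x) m \<alpha> h q"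
    unfolding isosceles_RE_def relative_equilibrium_at_height_def by (simp add: q_def)
  moreover have "range (\<lambda>i. q i 0) = apex_triangle P h x 0"
    unfolding UNIV_3 by (simp add: q_def apex_triangle_def)
  ultimately show thesis
    using that by blast
qed

subsection \<open>Shapes of triangles\<close>

definition screw_motion :: "real \<Rightarrow> real \<Rightarrow> real^3 \<Rightarrow> real^3" where
  "screw_motion \<gamma> d p =
     vector [cos \<gamma> * p$1 - sin \<gamma> * p$2, sin \<gamma> * p$1 + cos \<gamma> * p$2, p$3 + d]"

lemma dist_screw_motion: "dist (screw_motion \<gamma> d p) (screw_motion \<gamma> d q) = dist p q"
proof -
  have "(dist (screw_motion \<gamma> d p) (screw_motion \<gamma> d q))\<^sup>2
      = (cos \<gamma> * p$1 - sin \<gamma> * p$2 - (cos \<gamma> * q$1 - sin \<gamma> * q$2))\<^sup>2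
        + (sin \<gamma> * p$1 + cos \<gamma> * p$2 - (sin \<gamma> * q$1 + cos \<gamma> * q$2))\<^sup>2
        + (p$3 - q$3)\<^sup>2"
    unfolding dist_norm power2_norm_eq_inner
    by (simp add: screw_motion_def inner_vec_def sum_3 power2_eq_square)
  also have "\<dots> = ((sin \<gamma>)\<^sup>2 + (cos \<gamma>)\<^sup>2) * ((p$1 - q$1)\<^sup>2 + (p$2 - q$2)\<^sup>2) + (p$3 - q$3)\<^sup>2"
    by algebra
  also have "\<dots> = (dist p q)\<^sup>2"
    unfolding sin_cos_squared_add dist_norm power2_norm_eq_inner
    by (simp add: inner_vec_def sum_3 power2_eq_square)
  finally show ?thesis
    by (simp add: power2_eq_iff_nonneg)
qed

lemma screw_motion_circle_point:
  "screw_motion \<gamma> d (circle_point P h \<theta>) = circle_point P (h + d) (\<theta> + \<gamma>)"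
  by (simp add: vec_eq_iff forall_3 screw_motion_def cos_add sin_add algebra_simps)

lemma screw_motion_triangle:
  "screw_motion \<gamma> d ` apex_triangle P h x b = apex_triangle P (h + d) x (b + \<gamma>)"
  by (simp add: apex_triangle_def screw_motion_circle_point algebra_simps)

text \<open>Precomposing with a screw motion transports similarities between circles of one radius,
  so neither the height nor the phase affects the class. In particular the two symmetric circles and
  all instants contribute the same shapes.\<close>

lemma similarity_class_triangle:
  "similarity `` {apex_triangle P h x b} = similarity `` {apex_triangle P h' x b'}"
proof -
  have "similarity `` {apex_triangle P h' x b'} \<subseteq> similarity `` {apex_triangle P h x b}" for h b h' b'
  proof
    fix U
    assume "U \<in> similarity `` {apex_triangle P h' x b'}"
    then obtain c f where c: "c > 0" and f: "\<And>p q. dist (f p) (f q) = c * dist p q"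
      and U: "f ` apex_triangle P h' x b' = U"
      unfolding similarity_def by blast
    let ?g = "f \<circ> screw_motion (b' - b) (h' - h)"
    have "dist (?g p) (?g q) = c * dist p q" for p q
      by (simp add: f dist_screw_motion)
    moreover have "?g ` apex_triangle P h x b = U"
      unfolding image_comp[symmetric] screw_motion_triangle using U by simp
    ultimately show "U \<in> similarity `` {apex_triangle P h x b}"
      using c unfolding similarity_def by blast
  qed
  then show ?thesis
    by blast
qed

text \<open>A similarity multiplies all these numbers by one factor, so their ratio distinguishes
  shapes; squares keep them polynomial in the cosine.\<close>

definition squared_sides :: "(real^3) set \<Rightarrow> real set" where
  "squared_sides S = {(dist p q)\<^sup>2 | p q. p \<in> S \<and> q \<in> S \<and> p \<noteq> q}"

lemma squared_sides_similar:
  assumes "(S, T) \<in> similarity"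
  obtains c where "c > 0" "squared_sides T = (\<lambda>d. c * d) ` squared_sides S"
proof -
  obtain c f where c: "c > 0" and f: "\<And>p q. dist (f p) (f q) = c * dist p q" and T: "T = f ` S"
    using assms unfolding similarity_def by blast
  have eq_iff: "f p = f q \<longleftrightarrow> p = q" for p q
    using f[of p q] c by (metis dist_eq_0_iff less_irrefl mult_eq_0_iff)
  have "squared_sides T = {(dist (f p) (f q))\<^sup>2 | p q. p \<in> S \<and> q \<in> S \<and> f p \<noteq> f q}"
    unfolding squared_sides_def T by blast
  also have "\<dots> = {c\<^sup>2 * (dist p q)\<^sup>2 | p q. p \<in> S \<and> q \<in> S \<and> p \<noteq> q}"
    by (simp only: eq_iff f power_mult_distrib)
  also have "\<dots> = (\<lambda>d. c\<^sup>2 * d) ` squared_sides S"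
    unfolding squared_sides_def by blast
  finally show thesis
    using that[of "c\<^sup>2"] c by simp
qed

lemma squared_sides_three_points:
  assumes "A \<noteq> B" "A \<noteq> C" "B \<noteq> C"
  shows "squared_sides {A, B, C} = {(dist A B)\<^sup>2, (dist A C)\<^sup>2, (dist B C)\<^sup>2}"
proof -
  have "squared_sides {A, B, C}
      = (\<lambda>(p, q). (dist p q)\<^sup>2) ` {(p, q). p \<in> {A, B, C} \<and> q \<in> {A, B, C} \<and> p \<noteq> q}"
    unfolding squared_sides_def by auto
  also have "{(p, q). p \<in> {A, B, C} \<and> q \<in> {A, B, C} \<and> p \<noteq> q}
      = {(A, B), (B, A), (A, C), (C, A), (B, C), (C, B)}"
    using assms by auto
  finally show ?thesis
    by (simp add: dist_commute)
qed

text \<open>The base subtends twice the angle \<open>arccos x\<close>, and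
  \<open>1 - (2 * x\<^sup>2 - 1) = 2 * (1 - x) * (1 + x)\<close>. Hence \<open>2 * (1 + x)\<close>
  is the squared ratio of base to leg.\<close>

lemma squared_sides_triangle:
  assumes "P > 0" "- 1 < x" "x < 1"
  shows "squared_sides (apex_triangle P h x b) = {2 * P\<^sup>2 * (1 - x), 2 * P\<^sup>2 * (1 - x) * (2 * (1 + x))}"
proof -
  let ?A = "circle_point P h b"
  let ?B = "circle_point P h (b + arccos x)"
  let ?C = "circle_point P h (b - arccos x)"
  let ?l = "2 * P\<^sup>2 * (1 - x)"
  have cos2: "cos (2 * arccos x) = 2 * x\<^sup>2 - 1"
    unfolding cos_double_cos using assms by simp
  have AB: "(dist ?A ?B)\<^sup>2 = ?l" and AC: "(dist ?A ?C)\<^sup>2 = ?l"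
    unfolding dist_circle_point using assms by simp_all
  have BC: "(dist ?B ?C)\<^sup>2 = ?l * (2 * (1 + x))"
    unfolding dist_circle_point
    by (simp add: cos2) (simp add: algebra_simps power2_eq_square)
  have pos: "?l > 0" "?l * (2 * (1 + x)) > 0"
    using assms by simp_all
  have "?A \<noteq> ?B" "?A \<noteq> ?C" "?B \<noteq> ?C"
    using pos AB AC BC by (metis dist_self less_irrefl zero_power2)+
  then have "squared_sides (apex_triangle P h x b)
      = {(dist ?A ?B)\<^sup>2, (dist ?A ?C)\<^sup>2, (dist ?B ?C)\<^sup>2}"
    unfolding apex_triangle_def by (rule squared_sides_three_points)
  then show ?thesis
    unfolding AB AC BC by simp
qed

text \<open>For \<open>x > - 1 / 2\<close> the base is the longest side, so a similarity maps base to base.\<close>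

lemma similar_triangles_eq:
  assumes "P > 0" "- 1 / 2 < x" "x < 0" "- 1 / 2 < y" "y < 0"
    and "(apex_triangle P h x b, apex_triangle P h' y b') \<in> similarity"
  shows "x = y"
proof -
  define l where "l z = 2 * P\<^sup>2 * (1 - z)" for z
  have sides: "squared_sides (apex_triangle P h x b) = {l x, l x * (2 * (1 + x))}"
    "squared_sides (apex_triangle P h' y b') = {l y, l y * (2 * (1 + y))}"
    using assms by (simp_all add: squared_sides_triangle l_def)
  obtain c where "c > 0" and c: "{l y, l y * (2 * (1 + y))} = {c * l x, c * l x * (2 * (1 + x))}"
    using squared_sides_similar[OF assms(6)] unfolding sides by (auto simp: mult.assoc)
  have pos: "l y > 0" "c * l x > 0"
    using assms \<open>c > 0\<close> by (simp_all add: l_def)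
  have less: "z < z * (2 * (1 + w))" if "z > 0" "- 1 / 2 < w" for z w :: real
    using that mult_strict_left_mono[of 1 "2 * (1 + w)" z] by simp
  \<comment> \<open>The other way of matching the two sets would identify the smaller element of
    each with the larger one of the other.\<close>
  have "l y = c * l x \<and> l y * (2 * (1 + y)) = c * l x * (2 * (1 + x))"
    using c less[OF pos(1) assms(4)] less[OF pos(2) assms(2)]
    unfolding doubleton_eq_iff by linarith
  then show ?thesis
    using pos by auto
qed

section \<open>The shape equation and the number of its admissible roots\<close>

definition shape_parameters :: "real \<Rightarrow> real set" where
  "shape_parameters r =
     {x. - 1 < x \<and> x < 0 \<and> x \<noteq> - 1 / 2 \<and> (1 - r\<^sup>2) * ((1 - x) * (3 + 2 * x)) = 2}"

definition circle_radius :: "real \<Rightarrow> real \<Rightarrow> real" where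
  "circle_radius \<kappa> r = sqrt ((1 - r\<^sup>2) / \<kappa>)"

text \<open>On the sphere a circle at this distance from the equatorial plane has
  \<open>\<kappa> * P\<^sup>2 = 1 - r\<^sup>2\<close>. This fixes the radius and turns the shape
  equation into one in which \<kappa> no longer occurs.\<close>

lemma RE_circle_iff:
  assumes "\<kappa> > 0" "\<bar>h - (- 1 / sqrt \<kappa>)\<bar> = r / sqrt \<kappa>"
  shows "RE_circle \<kappa> P h x \<longleftrightarrow> P = circle_radius \<kappa> r \<and> x \<in> shape_parameters r"
proof -
  have "sqrt \<kappa> * \<bar>h - (- 1 / sqrt \<kappa>)\<bar> = \<bar>sqrt \<kappa> * h + 1\<bar>"
    using assms(1) by (simp add: abs_mult_pos' distrib_left)
  then have "\<bar>sqrt \<kappa> * h + 1\<bar> = r"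
    using assms by simp
  then have Z: "(sqrt \<kappa> * h + 1)\<^sup>2 = r\<^sup>2"
    by (metis power2_abs)
  have P: "0 < P \<and> \<kappa> * P\<^sup>2 = 1 - r\<^sup>2 \<longleftrightarrow> r\<^sup>2 < 1 \<and> P = circle_radius \<kappa> r"
  proof
    assume *: "0 < P \<and> \<kappa> * P\<^sup>2 = 1 - r\<^sup>2"
    then have "P\<^sup>2 = (1 - r\<^sup>2) / \<kappa>"
      using assms(1) by (simp add: field_simps)
    then have "P = circle_radius \<kappa> r"
      unfolding circle_radius_def using * by (metis less_imp_le real_sqrt_unique)
    moreover have "\<kappa> * P\<^sup>2 > 0"
      using conjunct1[OF *] assms(1) by simp
    ultimately show "r\<^sup>2 < 1 \<and> P = circle_radius \<kappa> r"
      using conjunct2[OF *] by simp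
  next
    assume "r\<^sup>2 < 1 \<and> P = circle_radius \<kappa> r"
    then show "0 < P \<and> \<kappa> * P\<^sup>2 = 1 - r\<^sup>2"
      using assms(1) by (simp add: circle_radius_def)
  qed
  have "r\<^sup>2 < 1" if "x \<in> shape_parameters r"
  proof -
    have "(1 - r\<^sup>2) * ((1 - x) * (3 + 2 * x)) > 0" "(1 - x) * (3 + 2 * x) > 0"
      using that by (simp_all add: shape_parameters_def)
    then show ?thesis
      by (simp add: zero_less_mult_iff)
  qed
  moreover have "RE_circle \<kappa> P h x \<longleftrightarrow> (0 < P \<and> \<kappa> * P\<^sup>2 = 1 - r\<^sup>2) \<and> x \<in> shape_parameters r"
  proof (cases "\<kappa> * P\<^sup>2 = 1 - r\<^sup>2")
    case True
    then show ?thesis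
      by (simp add: RE_circle_def shape_parameters_def Z)
  next
    case False
    then have "\<kappa> * P\<^sup>2 + r\<^sup>2 \<noteq> 1"
      by linarith
    with False show ?thesis
      by (simp add: RE_circle_def Z)
  qed
  ultimately show ?thesis
    unfolding P by blast
qed

text \<open>Height and phase do not matter up to similarity, so every class is represented at height
  0 and phase 0. Conversely each parameter is realised by suitable masses.\<close>

lemma RE_shapes_eq:
  assumes "\<kappa> > 0" "r > 0"
  shows "RE_shapes \<kappa> r
    = (\<lambda>x. similarity `` {apex_triangle (circle_radius \<kappa> r) 0 x 0}) ` shape_parameters r"
proof -
  have h_ne: "h \<noteq> - 1 / sqrt \<kappa>" if "\<bar>h - (- 1 / sqrt \<kappa>)\<bar> = r / sqrt \<kappa>" for h
    using that assms by auto
  have "\<exists>x\<in>shape_parameters r. \<exists>h b. S = apex_triangle (circle_radius \<kappa> r) h x b"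
    if "S \<in> RE_triangles \<kappa> r" for S
  proof -
    from that obtain q t M m \<alpha> h where S: "S = range (\<lambda>i. q i t)" and "0 < M" "0 < m"
      and h: "\<bar>h - (- 1 / sqrt \<kappa>)\<bar> = r / sqrt \<kappa>" and q: "isosceles_RE \<kappa> M m \<alpha> h q"
      unfolding RE_triangles_def by blast
    obtain P b where "RE_circle \<kappa> P h (- M / (2 * m))"
      and "\<alpha>\<^sup>2 = 2 * m * (1 - - M / (2 * m)) * pair_weight \<kappa> P (- M / (2 * m))"
      and "\<forall>t. range (\<lambda>i. q i t) = apex_triangle P h (- M / (2 * m)) (\<alpha> * t + b)"
      by (rule isosceles_RE_D[OF assms(1) \<open>0 < M\<close> \<open>0 < m\<close> h_ne[OF h] q])
    then show ?thesis
      using S RE_circle_iff[OF assms(1) h] by metis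
  qed
  moreover have "\<exists>h. apex_triangle (circle_radius \<kappa> r) h x 0 \<in> RE_triangles \<kappa> r"
    if "x \<in> shape_parameters r" for x
  proof -
    let ?h = "- 1 / sqrt \<kappa> + r / sqrt \<kappa>"
    have h: "\<bar>?h - (- 1 / sqrt \<kappa>)\<bar> = r / sqrt \<kappa>"
      using assms by simp
    have "RE_circle \<kappa> (circle_radius \<kappa> r) ?h x"
      using that RE_circle_iff[OF assms(1) h] by blast
    \<comment> \<open>Base masses are normalised to 1; then \<open>- 1 < x < 0\<close> says that the
      apex mass lies strictly between 0 and 2.\<close>
    then obtain \<alpha> q where q: "isosceles_RE \<kappa> (- 2 * 1 * x) 1 \<alpha> ?h q"
      and S: "range (\<lambda>i. q i 0) = apex_triangle (circle_radius \<kappa> r) ?h x 0"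
      using isosceles_RE_exists[OF assms(1) zero_less_one h_ne[OF h]] by blast
    have "0 < - 2 * 1 * x" "- 2 * 1 * x < 2 * 1"
      using that by (simp_all add: shape_parameters_def)
    then have "range (\<lambda>i. q i 0) \<in> RE_triangles \<kappa> r"
      unfolding RE_triangles_def using q h zero_less_one by blast
    then show ?thesis
      unfolding S by blast
  qed
  ultimately show ?thesis
    unfolding RE_shapes_def quotient_def
    by (auto simp: image_iff) (metis similarity_class_triangle)+
qed

text \<open>Completing the square shows that the two roots are symmetric about
  \<open>- 1/4\<close>.\<close>

lemma shape_parameters_square:
  fixes r x :: real
  assumes "r\<^sup>2 < 1"
  shows "(1 - r\<^sup>2) * ((1 - x) * (3 + 2 * x)) = 2 \<longleftrightarrow> (x + 1/4)\<^sup>2 = 25/16 - 1 / (1 - r\<^sup>2)"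
proof -
  define y where "y = (x + 1/4)\<^sup>2"
  have "(1 - x) * (3 + 2 * x) = 25/8 - 2 * y"
    by (simp add: y_def power2_eq_square algebra_simps)
  moreover have "(1 - r\<^sup>2) * (25/8 - 2 * y) = 2 \<longleftrightarrow> y = 25/16 - 1 / (1 - r\<^sup>2)"
    using assms by (simp add: field_simps) linarith
  ultimately show ?thesis
    by (simp add: y_def)
qed

text \<open>Distinct roots sum to \<open>- 1/2\<close>, so they cannot both lie below
  \<open>- 1/2\<close>; and for these \<open>r\<close> a root between \<open>- 1/2\<close> and 0
  would make the left side exceed 2.\<close>

lemma shape_parameters_small:
  assumes "r\<^sup>2 \<le> 1/3" "x \<in> shape_parameters r" "y \<in> shape_parameters r"
  shows "x = y"
proof -
  have small: "z < - 1 / 2" if "z \<in> shape_parameters r" for z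
  proof (rule ccontr)
    assume "\<not> z < - 1 / 2"
    then have z: "- 1 / 2 < z" "z < 0" and eq: "(1 - r\<^sup>2) * ((1 - z) * (3 + 2 * z)) = 2"
      using that by (auto simp: shape_parameters_def)
    \<comment> \<open>This product is \<open>(1 - z) * (3 + 2 * z) - 3\<close>.\<close>
    have "(- z) * (1 + 2 * z) > 0"
      using z by (intro mult_pos_pos) auto
    then have gt: "(1 - z) * (3 + 2 * z) > 3"
      by (simp add: algebra_simps)
    have "2 = (2/3) * (3::real)"
      by simp
    also have "\<dots> < (1 - r\<^sup>2) * ((1 - z) * (3 + 2 * z))"
      using gt assms(1) by (intro mult_le_less_imp_less) auto
    finally show False
      using eq by simp
  qed
  have "(1 - r\<^sup>2) * ((1 - x) * (3 + 2 * x)) = (1 - r\<^sup>2) * ((1 - y) * (3 + 2 * y))"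
    using assms by (simp add: shape_parameters_def)
  then have "(1 - x) * (3 + 2 * x) = (1 - y) * (3 + 2 * y)"
    using assms(1) by simp
  then have "(y - x) * (1 + 2 * (x + y)) = 0"
    by algebra
  then show ?thesis
    using small[OF assms(2)] small[OF assms(3)] by auto
qed

text \<open>The lower root \<open>- 1/4 - sqrt Q\<close> lies in \<open>(- 1, - 1/2)\<close> because
  \<open>1/4 < sqrt Q < 3/4\<close>, which is \<open>0 < r\<^sup>2 < 1/3\<close>. At
  \<open>r\<^sup>2 = 1/3\<close> the roots are 0 and \<open>- 1/2\<close>, both excluded.\<close>

lemma shape_parameters_small_nonempty:
  assumes "0 < r" "r\<^sup>2 < 1/3"
  shows "shape_parameters r \<noteq> {}"
proof -
  define Q where "Q = 25/16 - 1 / (1 - r\<^sup>2)"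
  have "1 - r\<^sup>2 < 1" "1 - r\<^sup>2 > 2/3"
    using assms by simp_all
  then have "1 < 1 / (1 - r\<^sup>2)" "1 / (1 - r\<^sup>2) < 3/2"
    by (simp_all add: field_simps)
  then have "(1/4)\<^sup>2 < Q" "Q < (3/4)\<^sup>2"
    by (simp_all add: Q_def power2_eq_square)
  moreover from this have "Q \<ge> 0"
    using zero_le_power2[of "1/4 :: real"] by linarith
  ultimately have Q: "1/4 < sqrt Q" "sqrt Q < 3/4" "Q \<ge> 0"
    by (blast intro: real_less_rsqrt, intro real_less_lsqrt, simp_all)
  have "(- 1/4 - sqrt Q + 1/4)\<^sup>2 = 25/16 - 1 / (1 - r\<^sup>2)"
    using Q(3) by (simp add: Q_def)
  then have "- 1/4 - sqrt Q \<in> shape_parameters r"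
    using Q assms shape_parameters_square[of r "- 1/4 - sqrt Q"] by (simp add: shape_parameters_def)
  then show ?thesis
    by blast
qed

text \<open>Here \<open>1 / (1 - r\<^sup>2) = 25/16\<close>, so the discriminant vanishes and the
  two roots merge.\<close>

lemma shape_parameters_three_fifths: "shape_parameters (3/5) = {- 1/4}"
proof -
  have "(1 - (3/5)\<^sup>2) * ((1 - x) * (3 + 2 * x)) = 2 \<longleftrightarrow> x = - 1/4" for x :: real
    using shape_parameters_square[of "3/5" x]
    by (auto simp: power2_eq_square add_eq_0_iff)
  then show ?thesis
    unfolding shape_parameters_def by auto
qed

text \<open>In this range \<open>0 < sqrt Q < 1/4\<close>, so both roots
  \<open>- 1/4 - sqrt Q\<close> and \<open>- 1/4 + sqrt Q\<close> are admissible and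
  distinct.\<close>

lemma shape_parameters_large:
  assumes "1/3 < r\<^sup>2" "r\<^sup>2 < 9/25"
  shows "card (shape_parameters r) = 2" "shape_parameters r \<subseteq> {- 1/2<..<0}"
proof -
  define Q where "Q = 25/16 - 1 / (1 - r\<^sup>2)"
  have "1 / (1 - r\<^sup>2) < 25/16" "3/2 < 1 / (1 - r\<^sup>2)"
    using assms by (simp_all add: field_simps)
  then have "0 < Q" "Q < (1/4)\<^sup>2"
    by (simp_all add: Q_def power2_eq_square)
  then have Q: "0 < sqrt Q" "sqrt Q < 1/4" "Q \<ge> 0"
    by (simp, intro real_less_lsqrt, simp_all)
  have eq: "(1 - r\<^sup>2) * ((1 - x) * (3 + 2 * x)) = 2 \<longleftrightarrow> x = - 1/4 - sqrt Q \<or> x = - 1/4 + sqrt Q" for x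
  proof -
    have "(x + 1/4)\<^sup>2 = Q \<longleftrightarrow> (x + 1/4)\<^sup>2 = (sqrt Q)\<^sup>2"
      using Q(3) by simp
    also have "\<dots> \<longleftrightarrow> x = - 1/4 - sqrt Q \<or> x = - 1/4 + sqrt Q"
      unfolding power2_eq_iff by auto
    finally show ?thesis
      using shape_parameters_square[of r x] assms by (simp add: Q_def)
  qed
  have "- 1 < x \<and> x < 0 \<and> x \<noteq> - 1 / 2" if "x = - 1/4 - sqrt Q \<or> x = - 1/4 + sqrt Q" for x
    using that Q by argo
  then have "shape_parameters r = {- 1/4 - sqrt Q, - 1/4 + sqrt Q}"
    unfolding shape_parameters_def eq by blast
  then show "card (shape_parameters r) = 2"
    using Q(1) by simp
  have "- 1/4 - sqrt Q \<in> {- 1/2<..<0}" "- 1/4 + sqrt Q \<in> {- 1/2<..<0}"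
    unfolding greaterThanLessThan_iff using Q by argo+
  then show "shape_parameters r \<subseteq> {- 1/2<..<0}"
    unfolding \<open>shape_parameters r = _\<close> by blast
qed

lemma card_RE_shapes:
  assumes "\<kappa> > 0" "sqrt 3 / 3 < r" "r < 3/5"
  shows "card (RE_shapes \<kappa> r) = 2"
proof -
  let ?c = "\<lambda>x. similarity `` {apex_triangle (circle_radius \<kappa> r) 0 x 0}"
  have "r > 0"
    by (rule order.strict_trans[OF _ assms(2)]) simp
  then have "(sqrt 3 / 3)\<^sup>2 < r\<^sup>2" "r\<^sup>2 < (3/5)\<^sup>2"
    using assms by (intro power_strict_mono; simp)+
  then have r: "1/3 < r\<^sup>2" "r\<^sup>2 < 9/25"
    by (simp_all add: power_divide)
  then have P: "circle_radius \<kappa> r > 0"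
    using assms(1) by (simp add: circle_radius_def)
  have refl: "(S, S) \<in> similarity" for S
    unfolding similarity_def by (auto intro!: exI[of _ 1] exI[of _ id])
  \<comment> \<open>By reflexivity, equal classes make the second triangle similar to the first;
    both parameters exceed \<open>- 1/2\<close>, where the shape determines the parameter.\<close>
  have "inj_on ?c (shape_parameters r)"
  proof (rule inj_onI)
    fix x y
    assume "x \<in> shape_parameters r" "y \<in> shape_parameters r" and eq: "?c x = ?c y"
    then have "x \<in> {- 1/2<..<0}" "y \<in> {- 1/2<..<0}"
      using shape_parameters_large(2)[OF r] by blast+
    moreover have "(apex_triangle (circle_radius \<kappa> r) 0 x 0, apex_triangle (circle_radius \<kappa> r) 0 y 0)
        \<in> similarity"
      using eq refl by blast
    ultimately show "x = y"
      using similar_triangles_eq[OF P] by simp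
  qed
  then show ?thesis
    unfolding RE_shapes_eq[OF assms(1) \<open>r > 0\<close>]
    using card_image shape_parameters_large(1)[OF r] by metis
qed

subsection \<open>The angular velocity\<close>

text \<open>The square root of \<open>2 * m * (1 - x) * pair_weight \<kappa> P x\<close> at
  \<open>x = - M / (2 * m)\<close>, with \<open>P\<close> eliminated by the shape equation.\<close>

definition angular_speed :: "real \<Rightarrow> real \<Rightarrow> real \<Rightarrow> real" where
  "angular_speed \<kappa> m M =
     sqrt ((2 * m + M) / (4 * m * (2 * m - M) / (\<kappa> * (3 * m - M)\<^sup>2)) powr (3/2))"

lemma angular_speed_pos:
  assumes "\<kappa> > 0" "M > 0" "m > 0" "M < 2 * m"
  shows "angular_speed \<kappa> m M > 0"
  using assms by (simp add: angular_speed_def)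

text \<open>The weight involves \<open>P\<close> only through
  \<open>s = P\<^sup>2 * (1 - x)\<close>, and the shape equation gives \<open>s\<close> in terms of
  \<kappa> and \<open>x\<close>.\<close>

lemma angular_speed_square:
  assumes "\<kappa> > 0" "M > 0" "m > 0" "RE_circle \<kappa> P h x" "x = - M / (2 * m)"
  shows "2 * m * (1 - x) * pair_weight \<kappa> P x = (angular_speed \<kappa> m M)\<^sup>2"
proof -
  have M: "M = - 2 * m * x"
    using assms(3,5) by simp
  have x: "- 1 < x" "x < 0" and shape: "\<kappa> * P\<^sup>2 * ((1 - x) * (3 + 2 * x)) = 2"
    using assms(4) unfolding RE_circle_def by blast+
  define s where "s = P\<^sup>2 * (1 - x)"
  have s: "s = 2 / (\<kappa> * (3 + 2 * x))"
  proof -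
    have "s * (\<kappa> * (3 + 2 * x)) = 2"
      unfolding s_def using shape by (simp add: mult_ac)
    then show ?thesis
      using x assms(1) by (simp add: eq_divide_eq)
  qed
  have "P\<^sup>2 * (1 - x) * (2 - \<kappa> * P\<^sup>2 * (1 - x)) = s * (2 - \<kappa> * s)"
    by (simp add: s_def)
  also have "\<dots> = 8 * (1 + x) / (\<kappa> * (3 + 2 * x)\<^sup>2)"
    using x assms(1) unfolding s by (simp add: divide_simps) (simp add: algebra_simps power2_eq_square)
  also have "\<dots> = 4 * m * (2 * m - M) / (\<kappa> * (3 * m - M)\<^sup>2)"
  proof -
    have "4 * m * (2 * m - M) = m\<^sup>2 * (8 * (1 + x))" "\<kappa> * (3 * m - M)\<^sup>2 = m\<^sup>2 * (\<kappa> * (3 + 2 * x)\<^sup>2)"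
      unfolding M by algebra+
    then show ?thesis
      using assms(3) by (simp only: mult_divide_mult_cancel_left power_not_zero) simp
  qed
  finally have E: "P\<^sup>2 * (1 - x) * (2 - \<kappa> * P\<^sup>2 * (1 - x)) = 4 * m * (2 * m - M) / (\<kappa> * (3 * m - M)\<^sup>2)" .
  have "2 * m * (1 - x) = 2 * m + M"
    unfolding M by algebra
  then show ?thesis
    using assms(2,3) unfolding angular_speed_def pair_weight_def E by simp
qed

text \<open>Clearing denominators and squaring removes the power \<open>3/2\<close>, leaving a
  rational identity that can be refuted at concrete values.\<close>

lemma angular_speed_eqD:
  assumes "\<kappa> > 0" "m > 0" "M > 0" "M < 2 * m" "\<kappa>' > 0" "m' > 0" "M' > 0" "M' < 2 * m'"
    and eq: "angular_speed \<kappa> m M = angular_speed \<kappa>' m' M'"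
  shows "(2 * m + M)\<^sup>2 * (4 * m' * (2 * m' - M') / (\<kappa>' * (3 * m' - M')\<^sup>2)) ^ 3
    = (2 * m' + M')\<^sup>2 * (4 * m * (2 * m - M) / (\<kappa> * (3 * m - M)\<^sup>2)) ^ 3"
proof -
  define E where "E = 4 * m * (2 * m - M) / (\<kappa> * (3 * m - M)\<^sup>2)"
  define E' where "E' = 4 * m' * (2 * m' - M') / (\<kappa>' * (3 * m' - M')\<^sup>2)"
  have pos: "E > 0" "E' > 0"
    using assms by (simp_all add: E_def E'_def)
  have cube: "(z powr (3/2))\<^sup>2 = z ^ 3" if "z > 0" for z :: real
  proof -
    have "(z powr (3/2))\<^sup>2 = z powr 3"
      by (simp add: power2_eq_square flip: powr_add)
    then show ?thesis
      using that by (simp add: powr_numeral)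
  qed
  have "(2 * m + M) / E powr (3/2) = (2 * m' + M') / E' powr (3/2)"
    using eq unfolding angular_speed_def E_def E'_def by simp
  then have "(2 * m + M) * E' powr (3/2) = (2 * m' + M') * E powr (3/2)"
    using pos by (simp add: frac_eq_eq)
  then have "((2 * m + M) * E' powr (3/2))\<^sup>2 = ((2 * m' + M') * E powr (3/2))\<^sup>2"
    by simp
  then show ?thesis
    unfolding power_mult_distrib cube[OF pos(1)] cube[OF pos(2)] by (simp add: E_def E'_def)
qed

text \<open>The point \<open>\<kappa> = 1, m = 2, M = 1\<close> is compared with points that differ
  from it in one argument each; the rational identity fails every time.\<close>

lemma angular_speed_depends:
  "depends_on_each (\<lambda>\<kappa> m M. 0 < \<kappa> \<and> 0 < M \<and> 0 < m \<and> M < 2 * m \<and> M \<noteq> m) angular_speed"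
  unfolding depends_on_each_def
proof (intro conjI)
  have "angular_speed 1 2 1 \<noteq> angular_speed 2 2 1"
    using angular_speed_eqD[of 1 2 1 2 2 1] by (auto simp: power2_eq_square power3_eq_cube)
  then show "\<exists>\<kappa> \<kappa>' m M. (0 < \<kappa> \<and> 0 < M \<and> 0 < m \<and> M < 2 * m \<and> M \<noteq> m) \<and>
      (0 < \<kappa>' \<and> 0 < M \<and> 0 < m \<and> M < 2 * m \<and> M \<noteq> m) \<and> angular_speed \<kappa> m M \<noteq> angular_speed \<kappa>' m M"
    by (intro exI[of _ "1::real"] exI[of _ "2::real"]) simp
next
  have "angular_speed 1 2 1 \<noteq> angular_speed 1 3 1"
    using angular_speed_eqD[of 1 2 1 1 3 1] by (auto simp: power2_eq_square power3_eq_cube)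
  then show "\<exists>\<kappa> m m' M. (0 < \<kappa> \<and> 0 < M \<and> 0 < m \<and> M < 2 * m \<and> M \<noteq> m) \<and>
      (0 < \<kappa> \<and> 0 < M \<and> 0 < m' \<and> M < 2 * m' \<and> M \<noteq> m') \<and> angular_speed \<kappa> m M \<noteq> angular_speed \<kappa> m' M"
    by (intro exI[of _ "1::real"] exI[of _ "2::real"] exI[of _ "3::real"]) simp
next
  have "angular_speed 1 2 1 \<noteq> angular_speed 1 2 3"
    using angular_speed_eqD[of 1 2 1 1 2 3] by (auto simp: power2_eq_square power3_eq_cube)
  then show "\<exists>\<kappa> m M M'. (0 < \<kappa> \<and> 0 < M \<and> 0 < m \<and> M < 2 * m \<and> M \<noteq> m) \<and>
      (0 < \<kappa> \<and> 0 < M' \<and> 0 < m \<and> M' < 2 * m \<and> M' \<noteq> m) \<and> angular_speed \<kappa> m M \<noteq> angular_speed \<kappa> m M'"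
    by (intro exI[of _ "1::real"] exI[of _ "2::real"] exI[of _ "3::real"]) simp
qed

text \<open>The radial balance determines only the square of \<alpha>, so the sense of rotation
  stays free.\<close>

lemma isosceles_RE_angular_speed:
  assumes "\<kappa> > 0" "M > 0" "m > 0" "M < 2 * m" "h \<noteq> - 1 / sqrt \<kappa>" "isosceles_RE \<kappa> M m \<alpha> h q"
  shows "\<bar>\<alpha>\<bar> = angular_speed \<kappa> m M"
proof -
  obtain P b where "RE_circle \<kappa> P h (- M / (2 * m))"
    and "\<alpha>\<^sup>2 = 2 * m * (1 - - M / (2 * m)) * pair_weight \<kappa> P (- M / (2 * m))"
    and "\<forall>t. range (\<lambda>i. q i t) = apex_triangle P h (- M / (2 * m)) (\<alpha> * t + b)"
    by (rule isosceles_RE_D[OF assms(1-3,5,6)])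
  then have "\<alpha>\<^sup>2 = (angular_speed \<kappa> m M)\<^sup>2"
    using angular_speed_square[OF assms(1-3)] by simp
  then show ?thesis
    using angular_speed_pos[OF assms(1-4)] by (simp add: power2_eq_iff abs_if split: if_splits) linarith
qed

text \<open>The masses fix \<open>x\<close>, and the shape equation
  \<open>(1 - r\<^sup>2) * k = 2\<close> is then solved for \<open>r\<close>.\<close>

lemma isosceles_RE_circles:
  assumes "\<kappa> > 0" "M > 0" "m > 0" "M < 2 * m" "M \<noteq> m"
  obtains r where "0 < r" "r \<le> 3/5"
    "\<And>h. h \<in> {- 1 / sqrt \<kappa> + r / sqrt \<kappa>, - 1 / sqrt \<kappa> - r / sqrt \<kappa>} \<Longrightarrow>
      \<exists>\<alpha> q. isosceles_RE \<kappa> M m \<alpha> h q"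
proof -
  define x where "x = - M / (2 * m)"
  have x: "- 1 < x" "x < 0" "x \<noteq> - 1 / 2"
    using assms by (simp_all add: x_def field_simps)
  define k where "k = (1 - x) * (3 + 2 * x)"
  \<comment> \<open>This product is \<open>k - 2\<close>; its positivity gives \<open>r > 0\<close>,
    while the maximum \<open>25/8\<close> of \<open>k\<close>, attained at \<open>x = - 1/4\<close>,
    gives \<open>r \<le> 3/5\<close>.\<close>
  have "(1 + x) * (1 - 2 * x) > 0"
    using x by (intro mult_pos_pos) auto
  then have "k > 2"
    by (simp add: k_def algebra_simps)
  have "k = 25/8 - 2 * (x + 1/4)\<^sup>2"
    by (simp add: k_def power2_eq_square algebra_simps)
  then have "k \<le> 25/8"
    by simp
  define r where "r = sqrt (1 - 2 / k)"
  have "0 < 1 - 2 / k" "1 - 2 / k \<le> (3/5)\<^sup>2"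
    using \<open>k > 2\<close> \<open>k \<le> 25/8\<close> by (simp_all add: field_simps power2_eq_square)
  then have r: "0 < r" "r \<le> 3/5" "r\<^sup>2 = 1 - 2 / k"
    unfolding r_def by (simp, intro real_le_lsqrt, simp_all)
  have par: "x \<in> shape_parameters r"
    unfolding shape_parameters_def using x \<open>k > 2\<close> by (simp add: r(3) flip: k_def)
  have "\<exists>\<alpha> q. isosceles_RE \<kappa> M m \<alpha> h q"
    if h: "h \<in> {- 1 / sqrt \<kappa> + r / sqrt \<kappa>, - 1 / sqrt \<kappa> - r / sqrt \<kappa>}" for h
  proof -
    have h': "\<bar>h - (- 1 / sqrt \<kappa>)\<bar> = r / sqrt \<kappa>"
      using h r(1) assms(1) by auto
    then have "h \<noteq> - 1 / sqrt \<kappa>"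
      using r(1) assms(1) by auto
    moreover have "RE_circle \<kappa> (circle_radius \<kappa> r) h x"
      using RE_circle_iff[OF assms(1) h'] par by blast
    moreover have "- 2 * m * x = M"
      using assms(3) by (simp add: x_def)
    ultimately show ?thesis
      using isosceles_RE_exists[OF assms(1,3)] by metis
  qed
  then show thesis
    using that r(1,2) by blast
qed

text \<open>For \<open>M = m\<close> the parameter \<open>- M / (2 * m)\<close> is
  \<open>- 1/2\<close>, the equilateral triangle, hence the condition \<open>M \<noteq> m\<close>.
  At \<open>r = sqrt 3 / 3\<close> there is at most one shape but existence is not claimed, since
  both roots of the shape equation are then excluded values.\<close>

theorem theorem3:
  shows "\<exists>\<omega> :: real \<Rightarrow> real \<Rightarrow> real \<Rightarrow> real.
    depends_on_each (\<lambda>\<kappa> m M. 0 < \<kappa> \<and> 0 < M \<and> 0 < m \<and> M < 2 * m \<and> M \<noteq> m) \<omega> \<and>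
    (\<forall>\<kappa>>0.
      (\<forall>M m. 0 < M \<and> 0 < m \<and> M < 2 * m \<and> M \<noteq> m \<longrightarrow>
        (\<exists>r. 0 < r \<and> r \<le> 3/5 \<and>
          (\<forall>h \<in> {- 1 / sqrt \<kappa> + r / sqrt \<kappa>, - 1 / sqrt \<kappa> - r / sqrt \<kappa>}.
             \<exists>\<alpha> q. isosceles_RE \<kappa> M m \<alpha> h q)) \<and>
        \<omega> \<kappa> m M > 0 \<and>
        (\<forall>\<alpha> h q. h \<noteq> - 1 / sqrt \<kappa> \<and> isosceles_RE \<kappa> M m \<alpha> h q \<longrightarrow> \<bar>\<alpha>\<bar> = \<omega> \<kappa> m M)) \<and>
      (\<forall>r \<in> {0<..sqrt 3 / 3} \<union> {3/5}.
        (\<exists>\<^sub>\<le>\<^sub>1 s. s \<in> RE_shapes \<kappa> r) \<and>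
        (r \<noteq> sqrt 3 / 3 \<longrightarrow> RE_shapes \<kappa> r \<noteq> {})) \<and>
      (\<forall>r \<in> {sqrt 3 / 3<..<3/5}. card (RE_shapes \<kappa> r) = 2))"
proof (intro exI[of _ angular_speed] conjI angular_speed_depends allI impI ballI)
  fix \<kappa> :: real
  assume \<kappa>: "0 < \<kappa>"
  {
    fix M m :: real
    assume "0 < M \<and> 0 < m \<and> M < 2 * m \<and> M \<noteq> m"
    then have Mm: "0 < M" "0 < m" "M < 2 * m" "M \<noteq> m"
      by auto
    show "\<exists>r. 0 < r \<and> r \<le> 3/5 \<and>
          (\<forall>h \<in> {- 1 / sqrt \<kappa> + r / sqrt \<kappa>, - 1 / sqrt \<kappa> - r / sqrt \<kappa>}.
             \<exists>\<alpha> q. isosceles_RE \<kappa> M m \<alpha> h q)"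
      using isosceles_RE_circles[OF \<kappa> Mm] by metis
    show "0 < angular_speed \<kappa> m M"
      by (rule angular_speed_pos[OF \<kappa> Mm(1-3)])
    show "\<bar>\<alpha>\<bar> = angular_speed \<kappa> m M"
      if "h \<noteq> - 1 / sqrt \<kappa> \<and> isosceles_RE \<kappa> M m \<alpha> h q" for \<alpha> h q
      using isosceles_RE_angular_speed[OF \<kappa> Mm(1-3)] that by blast
  }
  {
    fix r :: real
    assume r: "r \<in> {0<..sqrt 3 / 3} \<union> {3/5}"
    then have "r > 0"
      by auto
    have third: "(sqrt 3 / 3)\<^sup>2 = (1/3 :: real)"
      by (simp add: power_divide)
    have le: "r\<^sup>2 \<le> 1/3" if "r \<noteq> 3/5"
      using power_mono[of r "sqrt 3 / 3" 2] r that \<open>r > 0\<close> third by auto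
    have lt: "r\<^sup>2 < 1/3" if "r \<noteq> 3/5" "r \<noteq> sqrt 3 / 3"
      using power_strict_mono[of r "sqrt 3 / 3" 2] r that \<open>r > 0\<close> third by auto
    have "x = y" if "x \<in> shape_parameters r" "y \<in> shape_parameters r" for x y
      using shape_parameters_small[of r x y] le that shape_parameters_three_fifths
      by (cases "r = 3/5") auto
    then show "\<exists>\<^sub>\<le>\<^sub>1 s. s \<in> RE_shapes \<kappa> r"
      unfolding RE_shapes_eq[OF \<kappa> \<open>r > 0\<close>] by (auto intro!: Uniq_I)
    show "RE_shapes \<kappa> r \<noteq> {}" if "r \<noteq> sqrt 3 / 3"
    proof (cases "r = 3/5")
      case True
      then show ?thesis
        unfolding RE_shapes_eq[OF \<kappa> \<open>r > 0\<close>] by (simp only: shape_parameters_three_fifths) simp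
    next
      case False
      then show ?thesis
        unfolding RE_shapes_eq[OF \<kappa> \<open>r > 0\<close>]
        using shape_parameters_small_nonempty[OF \<open>r > 0\<close> lt] that by simp
    qed
  }
  show "card (RE_shapes \<kappa> r) = 2" if "r \<in> {sqrt 3 / 3<..<3/5}" for r
    using card_RE_shapes[OF \<kappa>] that by simp
qed

end
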